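(* For any $\alpha,\tau>0$, the constant $\zeta>0$ in the definition of the adaptive estimator $\tilde L_*$ can be chosen sufficiently large, depending only on $(\alpha,\tau)$, such that for some constant $C>0$ depending only on $(\alpha,\tau)$ the following holds for every $d\ge1$, every $\eta\in\mathbb{R}^d$ with $|\eta_1|\ge\cdots\ge|\eta_d|>0$, every $\sigma>0$ and every integer $s\in[d]$: $$\sup_{\theta\in\Theta_s}\ \sup_{\mathcal P_\xi\in\mathcal G_{\alpha,\tau}^{\otimes}}\mathbb{E}_{\theta,\mathcal P_\xi}\big(\tilde L_*-L(\theta)\big)^2\ \le\ C\,\sigma^2\,\Phi_{\rm adp}(s;\eta).$$
   Context: Model: $[d]=\{1,\dots,d\}$; $\eta\in\mathbb{R}^d$ is known with $|\eta_1|\ge\cdots\ge|\eta_d|>0$; one observes $y_j=\theta_j+\sigma\xi_j$, $j\in[d]$, with $\theta\in\mathbb{R}^d$ unknown, $\sigma>0$ known, and $\xi_1,\dots,\xi_d$ independent with joint law $\mathcal P_\xi$; $\mathbb{E}_{\theta,\mathcal P_\xi}$ is the corresponding expectation. $L(\theta)=\sum_{j=1}^d\eta_j\theta_j$, $\Theta_s=\{\theta\in\mathbb{R}^d:\#\{j:\theta_j\ne0\}\le s\}$. Noise class: $\mathcal G_{\alpha,\tau}$ is the class of laws on $\mathbb{R}$ of random variables $W$ symmetric around $0$ with $\mathbb{E}(W^2)=1$ and $\mathbb{P}(|W|\ge t)\le2\exp\{-2(t/\tau)^\alpha\}$ for all $t\ge0$; $\mathcal G_{\alpha,\tau}^{\otimes}=\{\otimes_{j=1}^dP_j:P_j\in\mathcal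 G_{\alpha,\tau}\}$. Adaptive quantities: for real $s\in[1,d]$, $\beta_*(s)\in\mathbb{R}$ is the unique solution of $$\frac{\sum_{j=1}^d|\eta_j|\exp(-\beta_*/|\eta_j|^\alpha)}{\sqrt{\sum_{j=1}^d\eta_j^2\exp(-\beta_*/|\eta_j|^\alpha)}}=\frac{s}{2\sqrt{\log(es)}},$$ $\lambda_*(s)=(\max(\beta_*(s),0))^{1/\alpha}$, and $j_2(s)=\max\{j\in[d]:|\eta_j|\ge\lambda_*(s)\}$ ($0$ if no such $j$). For integer $s\in[d]$, $$\hat L_s^*=\sum_{j\le j_2(s)}\eta_jy_j+\sum_{j>j_2(s)}\eta_jy_j\mathbf 1\{|\eta_jy_j|>\sigma\tau\lambda_*(s)\}.$$ Let $s_*=\max\{s\in[d]:\lambda_*(s)>0\}$ ($0$ if empty), $s_0=s_*+1$. For real $s\in[1,d]$, $$\nu_*(s)=\sqrt{\log(es)\sum_{j=1}^d\eta_j^2\exp\big(-(\lambda_*(s)/|\eta_j|)^\alpha\big)},$$ $\Phi_*(s;\eta)=s^2\lambda_*^2(s)+\nu_*^2(s)$ if $s\le s_0$ and $\Phi_*(s;\eta)=\Phi_*(s_0;\eta)$ if $s>s_0$. Define $$\Phi_{\rm adp}(s;\eta)=\begin{cases}\max\{\Phi_*(s;\eta),\ \Phi_*(1;\eta)\log^2(e\min(s,s_0))\},&0<\alpha<2,\\ \Phi_*(s;\eta),&\alpha\ge2.\end{cases}$$ Adaptive estimator: given a constant $\zeta>0$, let $\omega_s=[\zeta\sigma^2\Phi_{\rm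 adp}(s;\eta)]^{1/2}$ and $$\hat s=\min\big\{s\in\{1,\dots,s_*\}:|\hat L_s^*-\hat L_{s'}^*|\le\omega_{s'}\text{ for all integers }s'\in(s,d]\big\},$$ with $\hat s=s_0$ if this set is empty. (If $s_*=d$, the index $s=d$ always belongs to the set, so $\hat s\le d$ always.) Then $\tilde L_*=\hat L^*_{\hat s}$. *)

theory Defs
  imports "HOL-Probability.Probability"
begin

text \<open>
  A vector of \<open>\<real>\<^sup>d\<close> is a function \<open>nat \<Rightarrow> real\<close> of which only the coordinates in \<open>{1..d}\<close> are used.
\<close>

definition lin_func :: "nat \<Rightarrow> (nat \<Rightarrow> real) \<Rightarrow> (nat \<Rightarrow> real) \<Rightarrow> real" where
  "lin_func d \<eta> \<theta> = (\<Sum>j=1..d. \<eta> j * \<theta> j)"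

definition sparse_set :: "nat \<Rightarrow> nat \<Rightarrow> (nat \<Rightarrow> real) set" where
  "sparse_set d s = {\<theta>. card {j \<in> {1..d}. \<theta> j \<noteq> 0} \<le> s}"

definition noise_class :: "real \<Rightarrow> real \<Rightarrow> real measure set" where
  "noise_class \<alpha> \<tau> = {P. prob_space P \<and> sets P = sets borel
     \<and> distr P borel uminus = P
     \<and> has_bochner_integral P (\<lambda>x. x\<^sup>2) 1
     \<and> (\<forall>t\<ge>0. measure P {x. \<bar>x\<bar> \<ge> t} \<le> 2 * exp (- 2 * (t / \<tau>) powr \<alpha>))}"

definition noise_class_prod :: "real \<Rightarrow> real \<Rightarrow> nat \<Rightarrow> (nat \<Rightarrow> real) measure set" where
  "noise_class_prod \<alpha> \<tau> d =
     {(\<Pi>\<^sub>M j\<in>{1..d}. P j) | P. \<forall>j\<in>{1..d}. P j \<in> noise_class \<alpha> \<tau>}"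

text \<open>
  For nonzero \<open>\<eta> 1, \<dots>, \<eta> d\<close> with \<open>d \<ge> 1\<close>, the left-hand side of the equation below is continuous
  and strictly decreasing in \<open>\<beta>\<close>, with limits \<open>\<infinity>\<close> at \<open>-\<infinity>\<close> and \<open>0\<close> at \<open>\<infinity>\<close>; so for \<open>s \<ge> 1\<close> there is
  exactly one solution.
\<close>

definition beta_star :: "real \<Rightarrow> nat \<Rightarrow> (nat \<Rightarrow> real) \<Rightarrow> real \<Rightarrow> real" where
  "beta_star \<alpha> d \<eta> s = (THE \<beta>.
     (\<Sum>j=1..d. \<bar>\<eta> j\<bar> * exp (- \<beta> / \<bar>\<eta> j\<bar> powr \<alpha>))
       / sqrt (\<Sum>j=1..d. (\<eta> j)\<^sup>2 * exp (- \<beta> / \<bar>\<eta> j\<bar> powr \<alpha>))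
     = s / (2 * sqrt (ln (exp 1 * s))))"

definition lambda_star :: "real \<Rightarrow> nat \<Rightarrow> (nat \<Rightarrow> real) \<Rightarrow> real \<Rightarrow> real" where
  "lambda_star \<alpha> d \<eta> s = (max (beta_star \<alpha> d \<eta> s) 0) powr (1 / \<alpha>)"

definition j2 :: "real \<Rightarrow> nat \<Rightarrow> (nat \<Rightarrow> real) \<Rightarrow> real \<Rightarrow> nat" where
  "j2 \<alpha> d \<eta> s = Max (insert 0 {j \<in> {1..d}. \<bar>\<eta> j\<bar> \<ge> lambda_star \<alpha> d \<eta> s})"

definition L_hat ::
  "real \<Rightarrow> real \<Rightarrow> nat \<Rightarrow> (nat \<Rightarrow> real) \<Rightarrow> real \<Rightarrow> nat \<Rightarrow> (nat \<Rightarrow> real) \<Rightarrow> real" where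
  "L_hat \<alpha> \<tau> d \<eta> \<sigma> s y =
     (\<Sum>j\<in>{1..j2 \<alpha> d \<eta> s}. \<eta> j * y j)
     + (\<Sum>j\<in>{j2 \<alpha> d \<eta> s<..d}.
          \<eta> j * y j * (if \<bar>\<eta> j * y j\<bar> > \<sigma> * \<tau> * lambda_star \<alpha> d \<eta> s then 1 else 0))"

definition s_star :: "real \<Rightarrow> nat \<Rightarrow> (nat \<Rightarrow> real) \<Rightarrow> nat" where
  "s_star \<alpha> d \<eta> = Max (insert 0 {s \<in> {1..d}. lambda_star \<alpha> d \<eta> (real s) > 0})"

definition s_zero :: "real \<Rightarrow> nat \<Rightarrow> (nat \<Rightarrow> real) \<Rightarrow> nat" where
  "s_zero \<alpha> d \<eta> = s_star \<alpha> d \<eta> + 1"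

definition nu_star :: "real \<Rightarrow> nat \<Rightarrow> (nat \<Rightarrow> real) \<Rightarrow> real \<Rightarrow> real" where
  "nu_star \<alpha> d \<eta> s = sqrt (ln (exp 1 * s) *
     (\<Sum>j=1..d. (\<eta> j)\<^sup>2 * exp (- ((lambda_star \<alpha> d \<eta> s / \<bar>\<eta> j\<bar>) powr \<alpha>))))"

definition Phi_star :: "real \<Rightarrow> nat \<Rightarrow> (nat \<Rightarrow> real) \<Rightarrow> real \<Rightarrow> real" where
  "Phi_star \<alpha> d \<eta> s =
     (let r = (if s \<le> real (s_zero \<alpha> d \<eta>) then s else real (s_zero \<alpha> d \<eta>))
      in r\<^sup>2 * (lambda_star \<alpha> d \<eta> r)\<^sup>2 + (nu_star \<alpha> d \<eta> r)\<^sup>2)"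

definition Phi_adp :: "real \<Rightarrow> nat \<Rightarrow> (nat \<Rightarrow> real) \<Rightarrow> real \<Rightarrow> real" where
  "Phi_adp \<alpha> d \<eta> s =
     (if \<alpha> < 2
      then max (Phi_star \<alpha> d \<eta> s)
             (Phi_star \<alpha> d \<eta> 1 * (ln (exp 1 * min s (real (s_zero \<alpha> d \<eta>))))\<^sup>2)
      else Phi_star \<alpha> d \<eta> s)"

definition omega :: "real \<Rightarrow> real \<Rightarrow> nat \<Rightarrow> (nat \<Rightarrow> real) \<Rightarrow> real \<Rightarrow> nat \<Rightarrow> real" where
  "omega \<zeta> \<alpha> d \<eta> \<sigma> s = sqrt (\<zeta> * \<sigma>\<^sup>2 * Phi_adp \<alpha> d \<eta> s)"

definition s_hat ::
  "real \<Rightarrow> real \<Rightarrow> real \<Rightarrow> nat \<Rightarrow> (nat \<Rightarrow> real) \<Rightarrow> real \<Rightarrow> (nat \<Rightarrow> real) \<Rightarrow> nat" where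
  "s_hat \<zeta> \<alpha> \<tau> d \<eta> \<sigma> y =
     (let S = {s \<in> {1..s_star \<alpha> d \<eta>}. \<forall>s'\<in>{s<..d}.
                 \<bar>L_hat \<alpha> \<tau> d \<eta> \<sigma> s y - L_hat \<alpha> \<tau> d \<eta> \<sigma> s' y\<bar> \<le> omega \<zeta> \<alpha> d \<eta> \<sigma> s'}
      in if S = {} then s_zero \<alpha> d \<eta> else Min S)"

definition L_tilde ::
  "real \<Rightarrow> real \<Rightarrow> real \<Rightarrow> nat \<Rightarrow> (nat \<Rightarrow> real) \<Rightarrow> real \<Rightarrow> (nat \<Rightarrow> real) \<Rightarrow> real" where
  "L_tilde \<zeta> \<alpha> \<tau> d \<eta> \<sigma> y = L_hat \<alpha> \<tau> d \<eta> \<sigma> (s_hat \<zeta> \<alpha> \<tau> d \<eta> \<sigma> y) y"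

text \<open>
  The mean squared error is a nonnegative integral, so that no integrability has to be presupposed:
  a non-integrable error counts as \<open>\<infinity>\<close>.
\<close>

definition mse ::
  "nat \<Rightarrow> (nat \<Rightarrow> real) \<Rightarrow> real \<Rightarrow> ((nat \<Rightarrow> real) \<Rightarrow> real) \<Rightarrow> (nat \<Rightarrow> real) \<Rightarrow> (nat \<Rightarrow> real) measure
     \<Rightarrow> ennreal" where
  "mse d \<eta> \<sigma> T \<theta> Q =
     (\<integral>\<^sup>+ \<xi>. ennreal ((T (\<lambda>j. \<theta> j + \<sigma> * \<xi> j) - lin_func d \<eta> \<theta>)\<^sup>2) \<partial>Q)"

end

theory Submission
  imports Defs
begin

text \<open>
  Write \<open>a\<^sub>j = \<bar>\<eta> j\<bar>\<close>, \<open>A(\<beta>) = \<Sum>\<^sub>j a\<^sub>j exp (- \<beta> / a\<^sub>j powr \<alpha>)\<close>, \<open>B(\<beta>) = \<Sum>\<^sub>j a\<^sub>j\<^sup>2 exp (- \<beta> / a\<^sub>j powr \<alpha>)\<close>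
  and \<open>F = A / sqrt B\<close>. By Chebyshev's sum inequality \<open>A(\<beta>') B(\<beta>) \<le> A(\<beta>) B(\<beta>')\<close> for \<open>\<beta> \<le> \<beta>'\<close>; this makes
  \<open>F\<close> strictly decreasing, so that \<open>\<beta>\<^sub>*\<close> is well defined and decreasing in \<open>s\<close>, and it limits the growth of the
  rate to a factor \<open>t\<^sup>2\<close> between sparsity levels \<open>s\<close> and \<open>t\<close>.

  For \<open>s \<le> t < t'\<close> the estimators with thresholds \<open>\<lambda> = \<lambda>\<^sub>*(t) \<ge> \<lambda>' = \<lambda>\<^sub>*(t')\<close> differ by
  \<open>X + R\<close>. The at most \<open>t\<close> coordinates in the support of \<open>\<theta>\<close> contribute \<open>\<bar>R\<bar> \<le> t \<tau> \<lambda>\<close>, which is at most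
  a constant times the root of the rate at \<open>t'\<close>. The others contribute a sum \<open>X\<close> of independent symmetric
  variables, bounded by \<open>\<tau> \<lambda>\<close>, whose variances are of order \<open>a\<^sub>j\<^sup>2 exp (- (\<lambda>' / a\<^sub>j) powr \<alpha>)\<close> with sum \<open>B\<close>
  at level \<open>t'\<close>. With \<open>L = ln (e t')\<close> and \<open>\<phi>\<close> the root of the adaptive rate at \<open>t'\<close>, Chernoff's bound with the single parameter
  \<open>u = L / \<phi>\<close> gives a deviation probability polynomially small in \<open>t'\<close>: for \<open>\<alpha> < 2\<close> the extra term of the
  rate yields \<open>u \<lambda> \<le> 1\<close>, for \<open>\<alpha> \<ge> 2\<close> the noise is sub-Gaussian and \<open>u \<lambda>' \<le> 1\<close> suffices.
  Lepski's argument then sums these bounds over all pairs of levels; the polynomial decay beats the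
  growth \<open>t\<^sup>2\<close> of the rate.
\<close>

section \<open>The rate and the thresholds\<close>

text \<open>This is \<open>ln x \<le> x - 1\<close> at
  \<open>x = c * \<alpha> * v powr \<alpha>\<close>; the prefactor is the best possible, attained
  where \<open>x = 1\<close>. It lets polynomial factors be paid for by a small share of an
  exponent.\<close>

lemma le_exp_powr:
  fixes c \<alpha> v :: real
  assumes "c > 0" "\<alpha> > 0" "v \<ge> 0"
  shows "v \<le> exp (- (ln (c * \<alpha>) + 1) / \<alpha>) * exp (c * v powr \<alpha>)"
proof (cases "v = 0")
  case False
  then have v: "v > 0" using assms by simp
  have "ln (c * \<alpha> * v powr \<alpha>) \<le> c * \<alpha> * v powr \<alpha> - 1"
    by (rule ln_le_minus_one) (use assms v in simp)
  then have "ln (c * \<alpha>) + \<alpha> * ln v \<le> c * \<alpha> * v powr \<alpha> - 1"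
    using assms v by (simp add: ln_mult ln_powr)
  then have "ln v \<le> - (ln (c * \<alpha>) + 1) / \<alpha> + c * v powr \<alpha>"
    using assms by (simp add: field_simps)
  then have "exp (ln v) \<le> exp (- (ln (c * \<alpha>) + 1) / \<alpha> + c * v powr \<alpha>)"
    by (simp only: exp_le_cancel_iff)
  then show ?thesis using v by (simp only: exp_ln exp_add)
qed (use assms in simp)

text \<open>The double sum of \<open>w i * w j * ((f i - f j) * (g i - g j))\<close> is nonnegative
  and expands to twice the difference of the two sides.\<close>

lemma weighted_Chebyshev:
  fixes w f g :: "'a \<Rightarrow> real"
  assumes "\<And>i. i \<in> I \<Longrightarrow> w i \<ge> 0"
    and "\<And>i j. i \<in> I \<Longrightarrow> j \<in> I \<Longrightarrow> 0 \<le> (f i - f j) * (g i - g j)"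
  shows "(\<Sum>i\<in>I. w i * f i) * (\<Sum>i\<in>I. w i * g i) \<le> (\<Sum>i\<in>I. w i) * (\<Sum>i\<in>I. w i * f i * g i)"
proof -
  have "0 \<le> (\<Sum>i\<in>I. \<Sum>j\<in>I. w i * w j * ((f i - f j) * (g i - g j)))"
    using assms by (intro sum_nonneg) (meson mult_nonneg_nonneg)
  also have "\<dots> = (\<Sum>i\<in>I. \<Sum>j\<in>I. (w i * f i * g i) * w j) + (\<Sum>i\<in>I. \<Sum>j\<in>I. w i * (w j * f j * g j))
      - (\<Sum>i\<in>I. \<Sum>j\<in>I. (w i * f i) * (w j * g j)) - (\<Sum>i\<in>I. \<Sum>j\<in>I. (w i * g i) * (w j * f j))"
    unfolding sum.distrib[symmetric] sum_subtractf[symmetric]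
    by (intro sum.cong refl) (simp add: algebra_simps)
  also have "\<dots> = 2 * ((\<Sum>i\<in>I. w i) * (\<Sum>i\<in>I. w i * f i * g i) - (\<Sum>i\<in>I. w i * f i) * (\<Sum>i\<in>I. w i * g i))"
    by (simp only: sum_product[symmetric]) (simp add: algebra_simps)
  finally show ?thesis by simp
qed

text \<open>With \<open>q = t / s\<close> this reduces to
  \<open>1 + ln t \<le> q\<^sup>2 * (1 + ln s)\<close>. Since the right-hand side of the defining
  equation grows while \<open>F\<close> decreases, the solution decreases in
  \<open>s\<close>.\<close>

lemma div_sqrt_ln_mono:
  fixes s t :: real
  assumes "1 \<le> s" "s \<le> t"
  shows "s / (2 * sqrt (ln (exp 1 * s))) \<le> t / (2 * sqrt (ln (exp 1 * t)))"
proof -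
  have L: "ln (exp 1 * s) = 1 + ln s" "ln (exp 1 * t) = 1 + ln t"
    using assms by (simp_all add: ln_mult)
  define q where "q = t / s"
  have q: "q \<ge> 1" "t = q * s" using assms by (simp_all add: q_def)
  have "ln t \<le> ln s + (q - 1)"
    using ln_le_minus_one[of q] assms q by (simp add: ln_mult)
  moreover have "q - 1 \<le> (q\<^sup>2 - 1) * (1 + ln s)"
  proof -
    have "q - 1 \<le> q\<^sup>2 - 1" using q by (simp add: power2_eq_square)
    also have "\<dots> \<le> (q\<^sup>2 - 1) * (1 + ln s)"
      using mult_left_mono[of 1 "1 + ln s" "q\<^sup>2 - 1"] assms q ln_ge_zero[of s] by (simp add: one_le_power)
    finally show ?thesis .
  qed
  ultimately have "1 + ln t \<le> q\<^sup>2 * (1 + ln s)" by (simp add: algebra_simps)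
  then have "sqrt (1 + ln t) \<le> sqrt (q\<^sup>2 * (1 + ln s))" by (rule real_sqrt_le_mono)
  also have "\<dots> = q * sqrt (1 + ln s)" using q by (simp add: real_sqrt_mult)
  finally have "sqrt (1 + ln t) * s \<le> t * sqrt (1 + ln s)"
    using assms q by (simp add: mult.commute mult.left_commute)
  moreover have "1 + ln s > 0" "1 + ln t > 0"
    using assms ln_ge_zero[of s] ln_ge_zero[of t] by linarith+
  ultimately show ?thesis unfolding L by (simp add: field_simps)
qed

text \<open>Prefactor of \<open>le_exp_powr\<close> for \<open>c = 1 - 1 / 2 powr \<alpha>\<close>,
  the share of the exponent \<beta> that is freed when the threshold
  \<open>\<beta> powr (1 / \<alpha>)\<close> is halved.\<close>

definition half_level_const :: "real \<Rightarrow> real" where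
  "half_level_const \<alpha> = exp (- (ln ((1 - 1 / 2 powr \<alpha>) * \<alpha>) + 1) / \<alpha>)"

section \<open>Monotonicity of \<open>F\<close> and solution of the defining equation\<close>

locale loss =
  fixes \<alpha> :: real and d :: nat and \<eta> :: "nat \<Rightarrow> real"
  assumes alpha_pos: "\<alpha> > 0" and d_ge_1: "d \<ge> 1"
    and anti: "antimono_on {1..d} (\<lambda>j. \<bar>\<eta> j\<bar>)" and eta_d: "\<bar>\<eta> d\<bar> > 0"
begin

definition A :: "real \<Rightarrow> real" where
  "A \<beta> = (\<Sum>j=1..d. \<bar>\<eta> j\<bar> * exp (- \<beta> / \<bar>\<eta> j\<bar> powr \<alpha>))"

definition B :: "real \<Rightarrow> real" where
  "B \<beta> = (\<Sum>j=1..d. (\<eta> j)\<^sup>2 * exp (- \<beta> / \<bar>\<eta> j\<bar> powr \<alpha>))"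

definition F :: "real \<Rightarrow> real" where
  "F \<beta> = A \<beta> / sqrt (B \<beta>)"

lemma eta_antimono: "1 \<le> i \<Longrightarrow> i \<le> j \<Longrightarrow> j \<le> d \<Longrightarrow> \<bar>\<eta> j\<bar> \<le> \<bar>\<eta> i\<bar>"
  using anti by (auto simp: monotone_on_def)

lemma eta_pos: "j \<in> {1..d} \<Longrightarrow> \<bar>\<eta> j\<bar> > 0"
  using eta_antimono[of j d] eta_d by auto

lemma A_pos: "A \<beta> > 0"
  unfolding A_def using d_ge_1 eta_pos by (intro sum_pos) auto

lemma B_pos: "B \<beta> > 0"
  unfolding B_def using d_ge_1 eta_pos by (intro sum_pos) auto

lemma F_pos: "F \<beta> > 0"
  by (simp add: F_def A_pos B_pos)

lemma A_strict_antimono: "\<beta> < \<beta>' \<Longrightarrow> A \<beta>' < A \<beta>"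
  unfolding A_def using d_ge_1 eta_pos
  by (intro sum_strict_mono) (auto intro!: divide_strict_right_mono)

lemma B_antimono: "\<beta> \<le> \<beta>' \<Longrightarrow> B \<beta>' \<le> B \<beta>"
  unfolding B_def by (intro sum_mono mult_left_mono) (auto intro!: divide_right_mono)

text \<open>Chebyshev's inequality with the summands of \<open>A \<beta>\<close> as weights, applied
  to \<open>\<bar>\<eta> j\<bar>\<close> and to the damping \<open>g j\<close> from \<beta> to
  \<beta>'. Both are nondecreasing in \<open>\<bar>\<eta> j\<bar>\<close>, since small coefficients
  are damped more.\<close>

lemma A_mult_B_le:
  assumes "\<beta> \<le> \<beta>'"
  shows "A \<beta>' * B \<beta> \<le> A \<beta> * B \<beta>'"
proof -
  define w where "w = (\<lambda>j. \<bar>\<eta> j\<bar> * exp (- \<beta> / \<bar>\<eta> j\<bar> powr \<alpha>))"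
  define g where "g = (\<lambda>j. exp (- (\<beta>' - \<beta>) / \<bar>\<eta> j\<bar> powr \<alpha>))"
  have mono: "g i \<le> g j" if "i \<in> {1..d}" "\<bar>\<eta> i\<bar> \<le> \<bar>\<eta> j\<bar>" for i j
  proof -
    have "\<bar>\<eta> i\<bar> powr \<alpha> \<le> \<bar>\<eta> j\<bar> powr \<alpha>" "0 < \<bar>\<eta> j\<bar> powr \<alpha> * \<bar>\<eta> i\<bar> powr \<alpha>"
      using that eta_pos[of i] alpha_pos by (auto intro: powr_mono2)
    then show ?thesis
      unfolding g_def using assms divide_left_mono[of "\<bar>\<eta> i\<bar> powr \<alpha>" "\<bar>\<eta> j\<bar> powr \<alpha>" "\<beta>' - \<beta>"]
      by (simp add: minus_divide_left[symmetric] del: minus_diff_eq)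
  qed
  have e: "w j * g j = \<bar>\<eta> j\<bar> * exp (- \<beta>' / \<bar>\<eta> j\<bar> powr \<alpha>)"
    "w j * \<bar>\<eta> j\<bar> * g j = (\<eta> j)\<^sup>2 * exp (- \<beta>' / \<bar>\<eta> j\<bar> powr \<alpha>)"
    "w j * \<bar>\<eta> j\<bar> = (\<eta> j)\<^sup>2 * exp (- \<beta> / \<bar>\<eta> j\<bar> powr \<alpha>)" for j
  proof -
    have "exp (- \<beta> / \<bar>\<eta> j\<bar> powr \<alpha>) * g j = exp (- \<beta>' / \<bar>\<eta> j\<bar> powr \<alpha>)"
      unfolding g_def exp_add[symmetric] by (simp add: diff_divide_distrib)
    then show "w j * g j = \<bar>\<eta> j\<bar> * exp (- \<beta>' / \<bar>\<eta> j\<bar> powr \<alpha>)"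
      by (simp add: w_def mult.assoc)
    then have "\<bar>\<eta> j\<bar> * (w j * g j) = \<bar>\<eta> j\<bar> * (\<bar>\<eta> j\<bar> * exp (- \<beta>' / \<bar>\<eta> j\<bar> powr \<alpha>))" by simp
    then show "w j * \<bar>\<eta> j\<bar> * g j = (\<eta> j)\<^sup>2 * exp (- \<beta>' / \<bar>\<eta> j\<bar> powr \<alpha>)"
      by (simp add: power2_eq_square mult_ac flip: mult.assoc[of "\<bar>\<eta> j\<bar>" "\<bar>\<eta> j\<bar>"])
    show "w j * \<bar>\<eta> j\<bar> = (\<eta> j)\<^sup>2 * exp (- \<beta> / \<bar>\<eta> j\<bar> powr \<alpha>)"
      by (simp add: w_def power2_eq_square mult_ac flip: mult.assoc[of "\<bar>\<eta> j\<bar>" "\<bar>\<eta> j\<bar>"])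
  qed
  have "(\<Sum>j=1..d. w j * \<bar>\<eta> j\<bar>) * (\<Sum>j=1..d. w j * g j)
      \<le> (\<Sum>j=1..d. w j) * (\<Sum>j=1..d. w j * \<bar>\<eta> j\<bar> * g j)"
  proof (rule weighted_Chebyshev)
    fix i j assume ij: "i \<in> {1..d}" "j \<in> {1..d}"
    show "0 \<le> (\<bar>\<eta> i\<bar> - \<bar>\<eta> j\<bar>) * (g i - g j)"
      using mono[of i j] mono[of j i] ij
      by (cases "\<bar>\<eta> i\<bar> \<le> \<bar>\<eta> j\<bar>") (auto intro: mult_nonpos_nonpos mult_nonneg_nonneg)
  qed (simp add: w_def)
  then show ?thesis
    unfolding e(1,2) unfolding e(3) unfolding A_def B_def w_def by (simp only: mult.commute)
qed

text \<open>After squaring, one factor is supplied by \<open>A_mult_B_le\<close>, and the strictness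
  comes from the strict decrease of \<open>A\<close>.\<close>

lemma F_strict_antimono:
  assumes "\<beta> < \<beta>'"
  shows "F \<beta>' < F \<beta>"
proof -
  have "(A \<beta>')\<^sup>2 * B \<beta> \<le> A \<beta>' * (A \<beta> * B \<beta>')"
    using A_mult_B_le[of \<beta> \<beta>'] assms A_pos[of \<beta>'] by (simp add: power2_eq_square mult.assoc)
  also have "\<dots> < A \<beta> * (A \<beta> * B \<beta>')"
    using A_strict_antimono[OF assms] A_pos B_pos by simp
  finally have "(A \<beta>')\<^sup>2 / B \<beta>' < (A \<beta>)\<^sup>2 / B \<beta>"
    using B_pos[of \<beta>] B_pos[of \<beta>'] by (simp add: field_simps power2_eq_square)
  then have "(F \<beta>')\<^sup>2 < (F \<beta>)\<^sup>2"
    using B_pos[of \<beta>] B_pos[of \<beta>'] by (simp add: F_def power_divide)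
  then show ?thesis
    using F_pos[of \<beta>] by (rule power2_less_imp_less[OF _ less_imp_le])
qed

lemma F_antimono: "\<beta> \<le> \<beta>' \<Longrightarrow> F \<beta>' \<le> F \<beta>"
  using F_strict_antimono[of \<beta> \<beta>'] by (cases "\<beta> = \<beta>'") auto

lemma F_continuous: "continuous_on S F"
proof -
  have "B x \<noteq> 0" for x using B_pos[of x] by simp
  then show ?thesis
    unfolding F_def A_def B_def using eta_pos
    by (intro continuous_intros) (auto simp: B_def)
qed

text \<open>Intermediate value theorem. From \<open>e * A \<le> B \<le> a * A\<close>, with
  \<open>e\<close> the smallest and \<open>a\<close> the largest coefficient, the square of
  \<open>F\<close> lies between \<open>A / a\<close> and \<open>A / e\<close>; it remains to make
  \<open>A\<close> large at one end and small at the other.\<close>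

lemma F_surj:
  assumes "c > 0"
  shows "\<exists>\<beta>. F \<beta> = c"
proof -
  have "1 \<in> {1..d}" "d \<in> {1..d}" using d_ge_1 by auto
  define a where "a = \<bar>\<eta> 1\<bar>"
  define e where "e = \<bar>\<eta> d\<bar>"
  have ae: "a > 0" "e > 0" using eta_pos \<open>1 \<in> {1..d}\<close> \<open>d \<in> {1..d}\<close> by (auto simp: a_def e_def)
  have bnds: "e \<le> \<bar>\<eta> j\<bar>" "\<bar>\<eta> j\<bar> \<le> a" if "j \<in> {1..d}" for j
    using that eta_antimono[of 1 j] eta_antimono[of j d] by (auto simp: a_def e_def)
  have sq: "(\<eta> j)\<^sup>2 = \<bar>\<eta> j\<bar> * \<bar>\<eta> j\<bar>" for j by (simp add: power2_eq_square)
  have BA: "B \<beta> \<le> a * A \<beta>" "e * A \<beta> \<le> B \<beta>" for \<beta>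
    unfolding A_def B_def sum_distrib_left sq mult.assoc using bnds
    by (auto intro!: sum_mono mult_right_mono)
  \<comment> \<open>Chosen so that the first summand of \<open>A\<close> alone equals
    \<open>a * c\<^sup>2\<close>.\<close>
  define b0 where "b0 = - (a powr \<alpha>) * ln (c\<^sup>2)"
  have "a * c\<^sup>2 = a * exp (- b0 / a powr \<alpha>)" using ae assms by (simp add: b0_def)
  also have "\<dots> \<le> A b0"
    unfolding A_def a_def using \<open>1 \<in> {1..d}\<close> by (intro member_le_sum[of 1]) auto
  finally have "c\<^sup>2 * (a * A b0) \<le> (A b0)\<^sup>2" using A_pos[of b0] by (simp add: power2_eq_square mult_ac)
  moreover have "c\<^sup>2 * B b0 \<le> c\<^sup>2 * (a * A b0)" using BA(1) by (intro mult_left_mono) auto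
  ultimately have "c\<^sup>2 \<le> (F b0)\<^sup>2" using B_pos[of b0] by (simp add: F_def power_divide field_simps)
  then have lo: "c \<le> F b0" using F_pos[of b0] by (rule power2_le_imp_le[OF _ less_imp_le])
  \<comment> \<open>The last argument gives
    \<open>A 0 * exp (- b1 / a powr \<alpha>) \<le> c\<^sup>2 * e\<close>. The others ensure
    \<open>b0 \<le> b1\<close> and \<open>b1 \<ge> 0\<close>; the latter makes every exponential at
    most the one belonging to \<open>a\<close>.\<close>
  define b1 where "b1 = max b0 (max 0 (a powr \<alpha> * ln (A 0 / (c\<^sup>2 * e))))"
  have "A b1 \<le> (\<Sum>j=1..d. \<bar>\<eta> j\<bar> * exp (- b1 / a powr \<alpha>))"
    unfolding A_def
  proof (intro sum_mono mult_left_mono)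
    fix j assume j: "j \<in> {1..d}"
    have "\<bar>\<eta> j\<bar> powr \<alpha> \<le> a powr \<alpha>" "0 < a powr \<alpha> * \<bar>\<eta> j\<bar> powr \<alpha>"
      using ae bnds[OF j] eta_pos[OF j] alpha_pos by (auto intro: powr_mono2)
    moreover have "b1 \<ge> 0" by (simp add: b1_def)
    ultimately show "exp (- b1 / \<bar>\<eta> j\<bar> powr \<alpha>) \<le> exp (- b1 / a powr \<alpha>)"
      using divide_left_mono[of "\<bar>\<eta> j\<bar> powr \<alpha>" "a powr \<alpha>" b1] by simp
  qed auto
  also have "\<dots> = A 0 * exp (- b1 / a powr \<alpha>)" by (simp add: A_def sum_distrib_right)
  also have "\<dots> \<le> A 0 * exp (- ln (A 0 / (c\<^sup>2 * e)))"
  proof -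
    have "a powr \<alpha> * ln (A 0 / (c\<^sup>2 * e)) \<le> b1" by (simp add: b1_def)
    then have "ln (A 0 / (c\<^sup>2 * e)) \<le> b1 / a powr \<alpha>"
      using ae by (simp add: pos_le_divide_eq mult.commute)
    then show ?thesis using A_pos[of 0] by simp
  qed
  also have "\<dots> = c\<^sup>2 * e" using A_pos[of 0] ae assms by (simp add: exp_minus)
  finally have "(A b1)\<^sup>2 \<le> c\<^sup>2 * (e * A b1)" using A_pos[of b1] by (simp add: power2_eq_square mult_ac)
  also have "\<dots> \<le> c\<^sup>2 * B b1" using BA(2) by (intro mult_left_mono) auto
  finally have "(F b1)\<^sup>2 \<le> c\<^sup>2" using B_pos[of b1] by (simp add: F_def power_divide field_simps)
  then have hi: "F b1 \<le> c" using assms by (rule power2_le_imp_le[OF _ less_imp_le])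
  have "b0 \<le> b1" by (simp add: b1_def)
  then show ?thesis
    using IVT2'[of F b1 c b0] hi lo F_continuous by blast
qed

text \<open>\<open>F_surj\<close> gives existence and strict monotonicity uniqueness, so the
  definite description denotes the solution.\<close>

lemma F_beta_star:
  assumes "s \<ge> 1"
  shows "F (beta_star \<alpha> d \<eta> s) = s / (2 * sqrt (ln (exp 1 * s)))"
proof -
  have "1 + ln s > 0" using assms ln_ge_zero[of s] by linarith
  then have "s / (2 * sqrt (ln (exp 1 * s))) > 0" using assms by (simp add: ln_mult)
  then obtain \<beta> where \<beta>: "F \<beta> = s / (2 * sqrt (ln (exp 1 * s)))" using F_surj by blast
  have "beta_star \<alpha> d \<eta> s = (THE \<beta>. F \<beta> = s / (2 * sqrt (ln (exp 1 * s))))"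
    by (simp add: beta_star_def F_def A_def B_def)
  also have "F \<dots> = s / (2 * sqrt (ln (exp 1 * s)))"
  proof (rule theI[of "\<lambda>\<beta>. F \<beta> = _", OF \<beta>])
    show "x = \<beta>" if "F x = s / (2 * sqrt (ln (exp 1 * s)))" for x
      using that \<beta> F_strict_antimono[of x \<beta>] F_strict_antimono[of \<beta> x] by (cases x \<beta> rule: linorder_cases) auto
  qed
  finally show ?thesis .
qed

lemma beta_star_antimono:
  assumes "1 \<le> s" "s \<le> t"
  shows "beta_star \<alpha> d \<eta> t \<le> beta_star \<alpha> d \<eta> s"
proof (rule ccontr)
  assume "\<not> ?thesis"
  then have "F (beta_star \<alpha> d \<eta> t) < F (beta_star \<alpha> d \<eta> s)" by (intro F_strict_antimono) simp
  then show False using F_beta_star[of s] F_beta_star[of t] div_sqrt_ln_mono[OF assms] assms by simp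
qed

section \<open>Truncated levels and the growth of the rate\<close>

definition b :: "real \<Rightarrow> real" where
  "b s = max (beta_star \<alpha> d \<eta> s) 0"

abbreviation lam :: "real \<Rightarrow> real" where
  "lam s \<equiv> lambda_star \<alpha> d \<eta> s"

lemma b_nonneg: "b s \<ge> 0" by (simp add: b_def)

lemma b_antimono: "1 \<le> s \<Longrightarrow> s \<le> t \<Longrightarrow> b t \<le> b s"
  using beta_star_antimono[of s t] by (auto simp: b_def)

lemma lam_eq: "lam s = b s powr (1 / \<alpha>)"
  by (simp add: lambda_star_def b_def)

lemma lam_nonneg: "lam s \<ge> 0" by (simp add: lam_eq)

lemma lam_antimono: "1 \<le> s \<Longrightarrow> s \<le> t \<Longrightarrow> lam t \<le> lam s"
  unfolding lam_eq using alpha_pos by (intro powr_mono2 b_antimono b_nonneg) auto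

lemma lam_pos_iff: "lam s > 0 \<longleftrightarrow> beta_star \<alpha> d \<eta> s > 0"
  by (auto simp: lam_eq b_def max_def)

lemma lam_powr: "(lam s / \<bar>\<eta> j\<bar>) powr \<alpha> = b s / \<bar>\<eta> j\<bar> powr \<alpha>"
  using alpha_pos b_nonneg by (simp add: lam_eq powr_divide powr_powr)

text \<open>Truncation at 0 can only raise the argument of the decreasing \<open>F\<close>. Where
  \<open>lam s > 0\<close> nothing is truncated, hence the equality in
  \<open>F_b_eq\<close>.\<close>

lemma F_b_le: "s \<ge> 1 \<Longrightarrow> F (b s) \<le> s / (2 * sqrt (ln (exp 1 * s)))"
  using F_antimono[of "beta_star \<alpha> d \<eta> s" "b s"] F_beta_star[of s] by (simp add: b_def)

lemma F_b_eq: "s \<ge> 1 \<Longrightarrow> lam s > 0 \<Longrightarrow> F (b s) = s / (2 * sqrt (ln (exp 1 * s)))"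
  using F_beta_star[of s] by (simp add: b_def lam_pos_iff max_def)

lemma ln_exp1_ge_1: "s \<ge> 1 \<Longrightarrow> ln (exp 1 * s :: real) \<ge> 1"
  by (simp add: ln_mult)

lemma nu_star_sq:
  assumes "s \<ge> 1"
  shows "(nu_star \<alpha> d \<eta> s)\<^sup>2 = ln (exp 1 * s) * B (b s)"
  using ln_exp1_ge_1[OF assms] B_pos[of "b s"]
  by (simp add: nu_star_def lam_powr B_def)

text \<open>The value of \<open>A\<close> is known exactly at level \<open>s\<close> and bounded
  above at level \<open>t\<close>; inserting both into \<open>A_mult_B_le\<close> leaves a
  comparison of the square roots of \<open>B\<close>.\<close>

lemma nu_star_growth:
  assumes "1 \<le> s" "s \<le> t" "lam s > 0"
  shows "ln (exp 1 * t) * B (b t) \<le> t\<^sup>2 * (ln (exp 1 * s) * B (b s))"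
proof -
  define Ls where "Ls = sqrt (ln (exp 1 * s))"
  define Lt where "Lt = sqrt (ln (exp 1 * t))"
  have L: "Ls > 0" "Lt > 0" "ln (exp 1 * s) = Ls\<^sup>2" "ln (exp 1 * t) = Lt\<^sup>2"
    using ln_exp1_ge_1[of s] ln_exp1_ge_1[of t] assms unfolding Ls_def Lt_def
    by (simp_all del: ln_gt_zero_iff ln_ge_zero_iff)
  define Bs where "Bs = sqrt (B (b s))"
  define Bt where "Bt = sqrt (B (b t))"
  have Bp: "Bs > 0" "Bt > 0" "B (b s) = Bs\<^sup>2" "B (b t) = Bt\<^sup>2"
    using B_pos[of "b s"] B_pos[of "b t"] by (auto simp: Bs_def Bt_def)
  have "A (b s) = s * Bs / (2 * Ls)"
    using F_b_eq[of s] assms Bp L by (simp add: F_def Bs_def[symmetric] Ls_def[symmetric] field_simps)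
  moreover have "A (b t) \<le> t * Bt / (2 * Lt)"
    using F_b_le[of t] assms Bp L by (simp add: F_def Bt_def[symmetric] Lt_def[symmetric] field_simps)
  moreover have "A (b s) * B (b t) \<le> A (b t) * B (b s)"
    using A_mult_B_le[OF b_antimono] assms by simp
  ultimately have "s * Bs / (2 * Ls) * Bt\<^sup>2 \<le> t * Bt / (2 * Lt) * Bs\<^sup>2"
    unfolding Bp using Bp by (smt (verit) mult_right_mono zero_le_power2)
  then have "(Bs * Bt) * (s * Lt * Bt) \<le> (Bs * Bt) * (t * Ls * Bs)"
    using L Bp assms by (simp add: field_simps power2_eq_square)
  then have "s * (Lt * Bt) \<le> t * (Ls * Bs)" using Bp by (simp add: mult.assoc)
  \<comment> \<open>The spare factor \<open>s \<ge> 1\<close> on the smaller side is given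
    away.\<close>
  moreover have "Lt * Bt \<le> s * (Lt * Bt)" using mult_right_mono[of 1 s "Lt * Bt"] assms L Bp by simp
  ultimately have "Lt * Bt \<le> t * (Ls * Bs)" by simp
  then have "(Lt * Bt)\<^sup>2 \<le> (t * (Ls * Bs))\<^sup>2"
    using L Bp by (intro power_mono) auto
  then show ?thesis unfolding L Bp by (simp add: power_mult_distrib)
qed

text \<open>The formula of \<open>Phi_star\<close> before the level is clipped at
  \<open>s_zero\<close>, with the square of \<open>nu_star\<close> expressed through
  \<open>B\<close>.\<close>

definition rate :: "real \<Rightarrow> real" where
  "rate s = s\<^sup>2 * (lam s)\<^sup>2 + ln (exp 1 * s) * B (b s)"

lemma rate_pos: "s \<ge> 1 \<Longrightarrow> rate s > 0"
  using ln_exp1_ge_1[of s] B_pos[of "b s"] unfolding rate_def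
  by (intro add_nonneg_pos mult_pos_pos) (auto simp del: ln_gt_zero_iff)

lemma two_powr_gt_1: "2 powr \<alpha> > 1"
  using alpha_pos by simp

text \<open>Term by term, the factor
  \<open>\<beta> powr (1 / \<alpha>) / \<bar>\<eta> j\<bar>\<close> is absorbed by the gap between
  the exponents at \<beta> and at \<open>\<beta> / 2 powr \<alpha>\<close>.\<close>

lemma A_le_B:
  assumes "\<beta> \<ge> 0" "\<mu> \<le> \<beta> / 2 powr \<alpha>"
  shows "\<beta> powr (1 / \<alpha>) * A \<beta> \<le> half_level_const \<alpha> * B \<mu>"
  unfolding A_def B_def sum_distrib_left
proof (intro sum_mono)
  fix j assume j: "j \<in> {1..d}"
  define a where "a = \<bar>\<eta> j\<bar>"
  define c where "c = 1 - 1 / 2 powr \<alpha>"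
  have a: "a > 0" "(\<eta> j)\<^sup>2 = a * a" using eta_pos[OF j] by (simp_all add: a_def power2_eq_square)
  have "c > 0" using two_powr_gt_1 by (simp add: c_def)
  have "\<beta> powr (1 / \<alpha>) / a \<le> half_level_const \<alpha> * exp (c * (\<beta> powr (1 / \<alpha>) / a) powr \<alpha>)"
    unfolding half_level_const_def c_def[symmetric] using \<open>c > 0\<close> alpha_pos a by (intro le_exp_powr) auto
  also have "(\<beta> powr (1 / \<alpha>) / a) powr \<alpha> = \<beta> / a powr \<alpha>"
    using assms alpha_pos by (simp add: powr_divide powr_powr)
  finally have *: "\<beta> powr (1 / \<alpha>) \<le> a * half_level_const \<alpha> * exp (c * (\<beta> / a powr \<alpha>))"
    using a by (simp add: field_simps)
  have "\<mu> / a powr \<alpha> \<le> (\<beta> / 2 powr \<alpha>) / a powr \<alpha>"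
    using assms by (intro divide_right_mono) auto
  then have "c * (\<beta> / a powr \<alpha>) + - \<beta> / a powr \<alpha> \<le> - \<mu> / a powr \<alpha>"
    by (simp add: c_def algebra_simps)
  then have "exp (c * (\<beta> / a powr \<alpha>)) * exp (- \<beta> / a powr \<alpha>) \<le> exp (- \<mu> / a powr \<alpha>)"
    by (simp add: exp_add[symmetric])
  then have "a * half_level_const \<alpha> * (a * (exp (c * (\<beta> / a powr \<alpha>)) * exp (- \<beta> / a powr \<alpha>)))
      \<le> a * half_level_const \<alpha> * (a * exp (- \<mu> / a powr \<alpha>))"
    using a by (intro mult_left_mono) (auto simp: half_level_const_def)
  moreover have "\<beta> powr (1 / \<alpha>) * (a * exp (- \<beta> / a powr \<alpha>))
      \<le> a * half_level_const \<alpha> * exp (c * (\<beta> / a powr \<alpha>)) * (a * exp (- \<beta> / a powr \<alpha>))"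
    using * a by (intro mult_right_mono) auto
  ultimately show "\<beta> powr (1 / \<alpha>) * (\<bar>\<eta> j\<bar> * exp (- \<beta> / \<bar>\<eta> j\<bar> powr \<alpha>))
      \<le> half_level_const \<alpha> * ((\<eta> j)\<^sup>2 * exp (- \<mu> / \<bar>\<eta> j\<bar> powr \<alpha>))"
    unfolding a(2) a_def[symmetric] by (simp add: mult_ac)
qed

text \<open>Up to a constant, \<open>rate\<close> is nondecreasing although \<open>s * lam s\<close> is not: either \<open>\<lambda>\<close> loses at most
  a factor 2 on the way from the maximiser of \<open>\<lambda> * F\<close> to \<open>t\<close>, or \<open>B\<close> is already large at half
  the maximiser.\<close>

lemma s_lam_le:
  assumes "1 \<le> s" "s \<le> t" "lam s > 0"
  shows "s * lam s \<le> max 2 (4 * half_level_const \<alpha>) * sqrt (rate t)"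
proof -
  define Ls where "Ls = sqrt (ln (exp 1 * s))"
  define Lt where "Lt = sqrt (ln (exp 1 * t))"
  have L: "Ls > 0" "Lt > 0" "ln (exp 1 * t) = Lt\<^sup>2" "Ls \<le> Lt"
    using ln_exp1_ge_1[of s] ln_exp1_ge_1[of t] assms unfolding Ls_def Lt_def
    by (simp_all del: ln_gt_zero_iff ln_ge_zero_iff)
  \<comment> \<open>\<open>G (b s)\<close> equals \<open>lam s * s / (2 * Ls)\<close>, so a bound on
    the maximum of \<open>G\<close> over the interval is enough.\<close>
  define G where "G = (\<lambda>\<beta>. \<beta> powr (1 / \<alpha>) * F \<beta>)"
  have "compact {b t..b s}" "{b t..b s} \<noteq> {}" using b_antimono assms by auto
  moreover have "continuous_on {b t..b s} G"
    unfolding G_def using b_nonneg[of t] alpha_pos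
    by (intro continuous_on_mult F_continuous continuous_on_powr' continuous_intros) auto
  ultimately obtain x where x: "b t \<le> x" "x \<le> b s" and "\<forall>y\<in>{b t..b s}. G y \<le> G x"
    using continuous_attains_sup[of "{b t..b s}" G] by auto
  then have max: "G y \<le> G x" if "b t \<le> y" "y \<le> b s" for y using that by auto
  have x0: "x \<ge> 0" using x b_nonneg[of t] by simp
  have Gs: "G (b s) = lam s * s / (2 * Ls)"
    using F_b_eq[of s] assms by (simp add: G_def lam_eq Ls_def)
  have Gx: "G (b s) \<le> G x" using max[of "b s"] x by simp
  have PPt: "rate t = (t * lam t)\<^sup>2 + (Lt * sqrt (B (b t)))\<^sup>2"
    using B_pos[of "b t"] by (simp add: rate_def L power_mult_distrib)
  have P1: "t * lam t \<le> sqrt (rate t)" unfolding PPt by (intro real_le_rsqrt) simp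
  have P2: "Lt * sqrt (B (b t)) \<le> sqrt (rate t)" unfolding PPt by (intro real_le_rsqrt) simp
  show ?thesis
  proof (cases "x / 2 powr \<alpha> \<le> b t")
    case True
    \<comment> \<open>The threshold at the maximiser is at most \<open>2 * lam t\<close>, and
      \<open>F x\<close> is at most \<open>F (b t)\<close>.\<close>
    then have "x \<le> 2 powr \<alpha> * b t" using two_powr_gt_1 by (simp add: field_simps)
    then have "x powr (1 / \<alpha>) \<le> (2 powr \<alpha> * b t) powr (1 / \<alpha>)"
      using x0 alpha_pos by (intro powr_mono2) auto
    also have "\<dots> = 2 * lam t"
      using alpha_pos b_nonneg[of t] by (simp add: powr_mult powr_powr lam_eq)
    finally have "G x \<le> 2 * lam t * F (b t)"
      unfolding G_def using F_antimono[of "b t" x] x F_pos[of x] by (intro mult_mono) (auto simp: lam_nonneg)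
    also have "\<dots> \<le> 2 * lam t * (t / (2 * Lt))"
      unfolding Lt_def using F_b_le[of t] assms by (intro mult_left_mono) (auto simp: lam_nonneg)
    finally have "lam s * s / (2 * Ls) \<le> 2 * lam t * (t / (2 * Lt))" using Gx Gs by simp
    also have "\<dots> \<le> 2 * lam t * (t / (2 * Ls))"
      using L assms by (intro mult_left_mono divide_left_mono) (auto simp: lam_nonneg)
    finally have "s * lam s \<le> 2 * (t * lam t)" using L by (simp add: field_simps)
    also have "\<dots> \<le> 2 * sqrt (rate t)" using P1 by simp
    also have "\<dots> \<le> max 2 (4 * half_level_const \<alpha>) * sqrt (rate t)" using rate_pos[of t] assms by (intro mult_right_mono) auto
    finally show ?thesis .
  next
    case False
    \<comment> \<open>\<open>y\<close> has half the threshold of \<open>x\<close> and still lies in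
      the interval, so maximality of \<open>G x\<close> gives
      \<open>F y \<le> 2 * F x\<close>.\<close>
    define y where "y = x / 2 powr \<alpha>"
    have y: "y \<ge> b t" "y \<le> x" "y \<le> b s"
    proof -
      have "x * 1 \<le> x * 2 powr \<alpha>" using x0 two_powr_gt_1 by (intro mult_left_mono) auto
      then show "y \<le> x" using two_powr_gt_1 by (simp add: y_def field_simps)
      then show "y \<le> b s" using x by simp
    qed (use False in \<open>simp add: y_def\<close>)
    have xp: "x > 0" using False x0 b_nonneg[of t] by (cases "x = 0") auto
    have yl: "y powr (1 / \<alpha>) = x powr (1 / \<alpha>) / 2"
      using alpha_pos x0 by (simp add: y_def powr_divide powr_powr)
    define l where "l = x powr (1 / \<alpha>)"
    have l: "l > 0" using xp by (simp add: l_def)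
    have "l / 2 * F y \<le> l * F x" using max[of y] y by (simp add: G_def yl l_def)
    then have Fy: "F y \<le> 2 * F x" using l by simp
    define Bx where "Bx = sqrt (B x)"
    define By where "By = sqrt (B y)"
    have Bp: "Bx > 0" "By > 0" "B x = Bx\<^sup>2" "B y = By\<^sup>2"
      unfolding Bx_def By_def using B_pos[of x] B_pos[of y] by simp_all
    have AF: "A x = F x * Bx" "A y = F y * By"
      unfolding F_def Bx_def By_def using B_pos[of x] B_pos[of y] by simp_all
    \<comment> \<open>Chebyshev turns the comparison of \<open>F\<close> into a comparison of
      \<open>B\<close> in the direction opposite to its monotonicity.\<close>
    have "F x * Bx * By\<^sup>2 \<le> F y * By * Bx\<^sup>2"
      using A_mult_B_le[OF y(2)] unfolding AF Bp(3,4) .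
    then have "(Bx * By) * (F x * By) \<le> (Bx * By) * (F y * Bx)"
      by (simp add: power2_eq_square mult_ac)
    then have "F x * By \<le> F y * Bx" using Bp by simp
    also have "\<dots> \<le> F x * (2 * Bx)" using Fy Bp by (simp add: mult_right_mono)
    finally have B2: "By \<le> 2 * Bx" using F_pos[of x] by simp
    \<comment> \<open>\<open>G x * Bx\<close> is \<open>l * A x\<close>, which \<open>A_le_B\<close>
      bounds by a multiple of \<open>B y\<close>, the square of \<open>By\<close>. Cancelling one
      factor \<open>By\<close> bounds \<open>G x\<close> itself.\<close>
    have "G x * By \<le> G x * (2 * Bx)" using B2 F_pos[of x] l by (intro mult_left_mono) (auto simp: G_def)
    also have "\<dots> = 2 * (l * A x)" by (simp add: G_def l_def AF)
    also have "\<dots> \<le> 2 * (half_level_const \<alpha> * B y)" using A_le_B[OF x0, of y] by (simp add: y_def l_def)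
    finally have "G x * By \<le> (2 * half_level_const \<alpha> * By) * By" using Bp by (simp add: power2_eq_square)
    then have "G x \<le> 2 * half_level_const \<alpha> * By" using Bp by simp
    also have "\<dots> \<le> 2 * half_level_const \<alpha> * sqrt (B (b t))"
      unfolding By_def using B_antimono[OF y(1)] by (intro mult_left_mono) (auto simp: half_level_const_def)
    finally have "lam s * s / (2 * Ls) \<le> 2 * half_level_const \<alpha> * sqrt (B (b t))" using Gx Gs by simp
    then have "s * lam s \<le> 4 * half_level_const \<alpha> * (Ls * sqrt (B (b t)))" using L by (simp add: field_simps)
    also have "\<dots> \<le> 4 * half_level_const \<alpha> * (Lt * sqrt (B (b t)))"
      using L B_pos[of "b t"] by (intro mult_left_mono mult_right_mono) (auto simp: half_level_const_def)
    also have "\<dots> \<le> 4 * half_level_const \<alpha> * sqrt (rate t)" using P2 by (intro mult_left_mono) (auto simp: half_level_const_def)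
    also have "\<dots> \<le> max 2 (4 * half_level_const \<alpha>) * sqrt (rate t)" using rate_pos[of t] assms by (intro mult_right_mono) auto
    finally show ?thesis .
  qed
qed

section \<open>Levels up to \<open>s0\<close> and the adaptive rate\<close>

abbreviation s0 :: nat where "s0 \<equiv> s_zero \<alpha> d \<eta>"

lemma s0_ge_1: "s0 \<ge> 1" by (simp add: s_zero_def)

lemma s_star_le: "s_star \<alpha> d \<eta> \<le> d"
  by (auto simp: s_star_def)

text \<open>\<open>lam\<close> is nonincreasing, so positivity at \<open>s_star\<close> passes to
  all smaller levels.\<close>

lemma lam_pos:
  assumes "1 \<le> t" "t < s0"
  shows "lam (real t) > 0"
proof -
  have "s_star \<alpha> d \<eta> \<in> insert 0 {s \<in> {1..d}. lam (real s) > 0}"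
    unfolding s_star_def by (intro Max_in) auto
  moreover have "t \<le> s_star \<alpha> d \<eta>" using assms by (simp add: s_zero_def)
  ultimately have "lam (real (s_star \<alpha> d \<eta>)) > 0" using assms by auto
  moreover have "lam (real (s_star \<alpha> d \<eta>)) \<le> lam (real t)"
    using assms \<open>t \<le> s_star \<alpha> d \<eta>\<close> by (intro lam_antimono) auto
  ultimately show ?thesis by simp
qed

lemma lam_zero:
  assumes "s0 \<le> t" "t \<le> d"
  shows "lam (real t) = 0"
proof (rule ccontr)
  assume "lam (real t) \<noteq> 0"
  then have "t \<in> insert 0 {s \<in> {1..d}. lam (real s) > 0}"
    using assms s0_ge_1 lam_nonneg[of t] by (auto simp: less_le)
  then have "t \<le> s_star \<alpha> d \<eta>" unfolding s_star_def by (intro Max_ge) auto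
  then show False using assms by (simp add: s_zero_def)
qed

lemma Phi_star_eq: "1 \<le> t \<Longrightarrow> t \<le> s0 \<Longrightarrow> Phi_star \<alpha> d \<eta> (real t) = rate (real t)"
  by (simp add: Phi_star_def Let_def nu_star_sq rate_def)

lemma rate_le_Phi_adp: "1 \<le> t \<Longrightarrow> t \<le> s0 \<Longrightarrow> rate (real t) \<le> Phi_adp \<alpha> d \<eta> (real t)"
  using Phi_star_eq[of t] by (simp add: Phi_adp_def)

lemma Phi_adp_pos: "1 \<le> t \<Longrightarrow> t \<le> s0 \<Longrightarrow> Phi_adp \<alpha> d \<eta> (real t) > 0"
  using rate_le_Phi_adp[of t] rate_pos[of t] by simp

text \<open>This keeps only \<open>(lam 1)\<^sup>2\<close> of \<open>rate 1\<close> in the second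
  term of the maximum. It is what bounds the Chernoff exponent when \<alpha> is below 2.\<close>

lemma Phi_adp_le_2:
  assumes "1 \<le> t" "t \<le> s0" "\<alpha> < 2"
  shows "(lam 1 * ln (exp 1 * real t))\<^sup>2 \<le> Phi_adp \<alpha> d \<eta> (real t)"
proof -
  have "(lam 1)\<^sup>2 \<le> rate 1" using B_pos[of "b 1"] by (simp add: rate_def)
  then have "(lam 1)\<^sup>2 * (ln (exp 1 * real t))\<^sup>2 \<le> rate 1 * (ln (exp 1 * real t))\<^sup>2"
    by (intro mult_right_mono) auto
  then show ?thesis
    using assms Phi_star_eq[of 1] s0_ge_1 by (simp add: Phi_adp_def power_mult_distrib)
qed

lemma ln_exp1_le: "s \<ge> 1 \<Longrightarrow> ln (exp 1 * s :: real) \<le> s"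
  using ln_le_minus_one[of s] by (simp add: ln_mult)

text \<open>The threshold term grows at most through its factor \<open>t\<^sup>2\<close>, because
  \<open>lam\<close> decreases; \<open>nu_star_growth\<close> handles the other term, and
  \<open>1 \<le> ln (exp 1 * x) \<le> x\<close> the logarithmic one. From
  \<open>s < t \<le> s0\<close> follows the required \<open>lam s > 0\<close>.\<close>

lemma Phi_adp_growth:
  assumes "1 \<le> s" "s < t" "t \<le> s0"
  shows "Phi_adp \<alpha> d \<eta> (real t) \<le> (real t)\<^sup>2 * Phi_adp \<alpha> d \<eta> (real s)"
proof -
  have ls: "lam (real s) > 0" using assms by (intro lam_pos) auto
  have "(lam (real t))\<^sup>2 \<le> (real s * lam (real s))\<^sup>2"
  proof (rule power_mono)
    have "lam (real t) \<le> lam (real s)" using assms by (intro lam_antimono) auto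
    also have "\<dots> \<le> real s * lam (real s)" using assms ls by (simp add: mult_le_cancel_right1)
    finally show "lam (real t) \<le> real s * lam (real s)" .
  qed (rule lam_nonneg)
  then have "(real t)\<^sup>2 * (lam (real t))\<^sup>2 \<le> (real t)\<^sup>2 * ((real s)\<^sup>2 * (lam (real s))\<^sup>2)"
    by (simp add: mult_left_mono power_mult_distrib)
  then have rate: "rate (real t) \<le> (real t)\<^sup>2 * rate (real s)"
    using nu_star_growth[of s t] assms ls unfolding rate_def distrib_left by (intro add_mono) auto
  have PP': "rate 1 * (ln (exp 1 * real t))\<^sup>2 \<le> (real t)\<^sup>2 * (rate 1 * (ln (exp 1 * real s))\<^sup>2)"
  proof -
    have "(ln (exp 1 * real t))\<^sup>2 \<le> (real t)\<^sup>2"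
      using assms ln_exp1_le[of t] ln_exp1_ge_1[of t] by (intro power_mono) (auto simp del: ln_ge_zero_iff)
    also have "\<dots> \<le> (real t)\<^sup>2 * (ln (exp 1 * real s))\<^sup>2"
      using assms ln_exp1_ge_1[of s] one_le_power[of "ln (exp 1 * real s)" 2] by (simp add: mult_le_cancel_left1)
    finally show ?thesis using rate_pos[of 1] mult_left_mono[of _ _ "rate 1"] by (simp add: mult_ac)
  qed
  have P1: "Phi_star \<alpha> d \<eta> 1 = rate 1" using Phi_star_eq[of 1] s0_ge_1 by simp
  have mn: "min (real t) (real s0) = real t" "min (real s) (real s0) = real s" using assms by auto
  have e: "Phi_star \<alpha> d \<eta> (real t) = rate (real t)" "Phi_star \<alpha> d \<eta> (real s) = rate (real s)"
    using assms by (auto intro: Phi_star_eq)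
  show ?thesis
  proof (cases "\<alpha> < 2")
    case True
    have "max (rate t) (rate 1 * (ln (exp 1 * real t))\<^sup>2)
        \<le> max ((real t)\<^sup>2 * rate s) ((real t)\<^sup>2 * (rate 1 * (ln (exp 1 * real s))\<^sup>2))"
      using rate PP' by (intro max.mono)
    also have "\<dots> = (real t)\<^sup>2 * max (rate s) (rate 1 * (ln (exp 1 * real s))\<^sup>2)"
      by (simp add: max_mult_distrib_left)
    finally show ?thesis using True by (simp add: Phi_adp_def e mn P1)
  qed (use rate in \<open>simp add: Phi_adp_def e\<close>)
qed

lemma Phi_adp_const: "s0 \<le> t \<Longrightarrow> Phi_adp \<alpha> d \<eta> (real t) = Phi_adp \<alpha> d \<eta> (real s0)"
  by (cases "t = s0") (auto simp: Phi_adp_def Phi_star_def)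

end

section \<open>Functionals of the noise\<close>

text \<open>A geometric series of ratio \<open>exp (- 1 / 2)\<close>, the gap between the tail
  exponent 2 and the moment exponent 3/2.\<close>

definition exp_moment_const :: real where
  "exp_moment_const = 2 * exp (3 / 2) * (1 / (1 - exp (- 1 / 2)))"

lemma exp_moment_const_ge_1: "exp_moment_const \<ge> 1"
proof -
  have "1 / (1 - exp (- 1 / 2 :: real)) \<ge> 1" by (simp add: field_simps)
  moreover have "2 * exp (3 / 2 :: real) \<ge> 1" using one_le_exp_iff[of "3/2::real"] by linarith
  ultimately show ?thesis
    unfolding exp_moment_const_def using mult_mono[of 1 "2 * exp (3 / 2 :: real)" 1 "1 / (1 - exp (- 1 / 2 :: real))"] by simp
qed

text \<open>Decomposition into integer layers of
  \<open>(\<bar>x\<bar> / \<tau>) powr \<alpha>\<close>: on layer \<open>k\<close> the integrand is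
  at most \<open>exp (3 / 2 * (k + 1))\<close>, while level \<open>k\<close> is reached with
  probability at most \<open>2 * exp (- 2 * k)\<close>.\<close>

lemma noise_exp_moment:
  assumes P: "P \<in> noise_class \<alpha> \<tau>" and pos: "\<alpha> > 0" "\<tau> > 0"
  shows "(\<integral>\<^sup>+ x. ennreal (exp (3 / 2 * (\<bar>x\<bar> / \<tau>) powr \<alpha>)) \<partial>P) \<le> ennreal exp_moment_const"
proof -
  interpret prob_space P using P by (simp add: noise_class_def)
  have sets[measurable_cong]: "sets P = sets borel" using P by (simp add: noise_class_def)
  define Y where "Y = (\<lambda>x. (\<bar>x\<bar> / \<tau>) powr \<alpha>)"
  have [measurable]: "Y \<in> borel_measurable P" unfolding Y_def by measurable
  have Y0: "Y x \<ge> 0" for x by (simp add: Y_def)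
  have tl: "measure P {x. \<bar>x\<bar> \<ge> t} \<le> 2 * exp (- 2 * (t / \<tau>) powr \<alpha>)" if "t \<ge> 0" for t
    using P that by (auto simp: noise_class_def)
  have tail: "emeasure P {x. Y x \<ge> real k} \<le> ennreal (2 * exp (- 2 * real k))" for k
  proof -
    have sub: "{x. Y x \<ge> real k} \<subseteq> {x. \<bar>x\<bar> \<ge> \<tau> * real k powr (1 / \<alpha>)}"
    proof clarify
      fix x assume "real k \<le> Y x"
      then have "real k powr (1 / \<alpha>) \<le> Y x powr (1 / \<alpha>)" using pos by (intro powr_mono2) auto
      also have "\<dots> = \<bar>x\<bar> / \<tau>" using pos by (simp add: Y_def powr_powr)
      finally show "\<tau> * real k powr (1 / \<alpha>) \<le> \<bar>x\<bar>" using pos by (simp add: field_simps)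
    qed
    have "emeasure P {x. Y x \<ge> real k} \<le> emeasure P {x. \<bar>x\<bar> \<ge> \<tau> * real k powr (1 / \<alpha>)}"
      by (intro emeasure_mono sub) (simp add: sets)
    also have "\<dots> = ennreal (measure P {x. \<bar>x\<bar> \<ge> \<tau> * real k powr (1 / \<alpha>)})"
      by (simp add: emeasure_eq_measure)
    also have "measure P {x. \<bar>x\<bar> \<ge> \<tau> * real k powr (1 / \<alpha>)}
        \<le> 2 * exp (- 2 * ((\<tau> * real k powr (1 / \<alpha>)) / \<tau>) powr \<alpha>)"
      using tl[of "\<tau> * real k powr (1 / \<alpha>)"] pos by simp
    also have "((\<tau> * real k powr (1 / \<alpha>)) / \<tau>) powr \<alpha> = real k" using pos by (simp add: powr_powr)
    finally show ?thesis by (simp add: ennreal_leI)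
  qed
  have "(\<integral>\<^sup>+ x. ennreal (exp (3 / 2 * Y x)) \<partial>P)
      \<le> (\<integral>\<^sup>+ x. (\<Sum>k. ennreal (exp (3 / 2 * (real k + 1))) * indicator {x. Y x \<ge> real k} x) \<partial>P)"
  proof (intro nn_integral_mono)
    fix x
    \<comment> \<open>The single summand at the integer part of \<open>Y x\<close> already
      dominates.\<close>
    define n where "n = nat \<lfloor>Y x\<rfloor>"
    have n: "real n \<le> Y x" "Y x \<le> real n + 1" using Y0[of x] by (auto simp: n_def)
    let ?f = "\<lambda>k. ennreal (exp (3 / 2 * (real k + 1))) * indicator {x. Y x \<ge> real k} x"
    have "ennreal (exp (3 / 2 * Y x)) \<le> ?f n" using n by (auto intro!: ennreal_leI)
    also have "\<dots> = sum ?f {n}"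
      by (subst sum.insert) simp_all
    also have "\<dots> \<le> suminf ?f" by (intro sum_le_suminf) auto
    finally show "ennreal (exp (3 / 2 * Y x)) \<le> suminf ?f" .
  qed
  also have "\<dots> = (\<Sum>k. ennreal (exp (3 / 2 * (real k + 1))) * emeasure P {x. Y x \<ge> real k})"
    by (subst nn_integral_suminf) (auto simp: nn_integral_cmult_indicator sets intro!: suminf_cong nn_integral_cmult_indicator)
  also have "\<dots> \<le> (\<Sum>k. ennreal (2 * exp (3 / 2) * exp (- 1 / 2) ^ k))"
  proof (intro suminf_le)
    fix k
    have "ennreal (exp (3 / 2 * (real k + 1))) * emeasure P {x. Y x \<ge> real k}
        \<le> ennreal (exp (3 / 2 * (real k + 1))) * ennreal (2 * exp (- 2 * real k))"
      by (intro mult_left_mono tail) auto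
    also have "\<dots> = ennreal (2 * exp (3 / 2) * exp (- 1 / 2) ^ k)"
      by (simp add: ennreal_mult[symmetric] exp_add[symmetric] exp_of_nat_mult[symmetric] algebra_simps)
    finally show "ennreal (exp (3 / 2 * (real k + 1))) * emeasure P {x. Y x \<ge> real k}
        \<le> ennreal (2 * exp (3 / 2) * exp (- 1 / 2) ^ k)" .
  qed auto
  also have "\<dots> = ennreal exp_moment_const"
    unfolding exp_moment_const_def
    by (intro suminf_ennreal_eq sums_mult geometric_sums) auto
  finally show ?thesis by (simp add: Y_def)
qed

lemma noise_nn_integral_le:
  assumes P: "P \<in> noise_class \<alpha> \<tau>" and pos: "\<alpha> > 0" "\<tau> > 0" and "c \<ge> 0"
    and le: "\<And>x. f x \<le> c * exp (3 / 2 * (\<bar>x\<bar> / \<tau>) powr \<alpha>)"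
  shows "(\<integral>\<^sup>+ x. ennreal (f x) \<partial>P) \<le> ennreal (c * exp_moment_const)"
proof -
  have sets[measurable_cong]: "sets P = sets borel" using P by (simp add: noise_class_def)
  have "(\<integral>\<^sup>+ x. ennreal (f x) \<partial>P) \<le> (\<integral>\<^sup>+ x. ennreal c * ennreal (exp (3 / 2 * (\<bar>x\<bar> / \<tau>) powr \<alpha>)) \<partial>P)"
    using le \<open>c \<ge> 0\<close> by (intro nn_integral_mono) (simp add: ennreal_mult[symmetric] ennreal_leI)
  also have "\<dots> = ennreal c * (\<integral>\<^sup>+ x. ennreal (exp (3 / 2 * (\<bar>x\<bar> / \<tau>) powr \<alpha>)) \<partial>P)"
    by (intro nn_integral_cmult) measurable
  also have "\<dots> \<le> ennreal c * ennreal exp_moment_const"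
    by (intro mult_left_mono noise_exp_moment[OF P pos]) auto
  finally show ?thesis using \<open>c \<ge> 0\<close> exp_moment_const_ge_1 by (simp add: ennreal_mult)
qed

text \<open>A function vanishing below the threshold \<open>\<tau> * r\<close> when
  \<open>r > 1\<close> gains \<open>exp (- (r powr \<alpha>))\<close> at the price of one unit of
  exponent: above the threshold \<open>y > r\<close>, and for \<open>r \<le> 1\<close> the factor
  \<open>exp 1\<close> suffices.\<close>

lemma gate_le:
  fixes r y \<alpha> :: real
  assumes "r > 1 \<Longrightarrow> r < y" "r \<ge> 0" "\<alpha> > 0"
  shows "1 \<le> exp 1 * (exp (- (r powr \<alpha>)) * exp (y powr \<alpha>))"
proof -
  have "r powr \<alpha> \<le> 1 + y powr \<alpha>"
  proof (cases "r > 1")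
    case True
    then have "r powr \<alpha> \<le> y powr \<alpha>" using assms by (intro powr_mono2) auto
    then show ?thesis by simp
  next
    case False
    then have "r powr \<alpha> \<le> 1" using assms by (intro powr_le1) auto
    then show ?thesis by (simp add: add_increasing2)
  qed
  then have "exp 0 \<le> exp (1 + (- (r powr \<alpha>) + y powr \<alpha>))" by (subst exp_le_cancel_iff) linarith
  then show ?thesis unfolding exp_add by simp
qed

text \<open>\<open>exp 1\<close> stems from \<open>gate_le\<close>, the squared bracket from
  \<open>le_exp_powr\<close> with \<open>c = 1 / 4\<close>.\<close>

definition sq_const :: "real \<Rightarrow> real \<Rightarrow> real" where
  "sq_const \<alpha> \<tau> = exp 1 * (\<tau> * exp (- (ln (1 / 4 * \<alpha>) + 1) / \<alpha>))\<^sup>2 * exp_moment_const"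

text \<open>The threshold costs one unit of exponent by \<open>gate_le\<close> and the square half a
  unit, which together use up the available 3/2.\<close>

lemma noise_sq_le:
  assumes P: "P \<in> noise_class \<alpha> \<tau>" and pos: "\<alpha> > 0" "\<tau> > 0"
    and \<psi>: "\<And>x. \<bar>\<psi> x\<bar> \<le> a * \<bar>x\<bar>" "\<And>x. r > 1 \<Longrightarrow> \<bar>x\<bar> \<le> \<tau> * r \<Longrightarrow> \<psi> x = 0"
    and "a > 0" "r \<ge> 0"
  shows "(\<integral>\<^sup>+ x. ennreal ((\<psi> x)\<^sup>2) \<partial>P) \<le> ennreal (sq_const \<alpha> \<tau> * (a\<^sup>2 * exp (- (r powr \<alpha>))))"
proof -
  define k where "k = exp (- (ln (1 / 4 * \<alpha>) + 1) / \<alpha>)"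
  define c where "c = exp 1 * (\<tau> * k)\<^sup>2 * (a\<^sup>2 * exp (- (r powr \<alpha>)))"
  have "(\<integral>\<^sup>+ x. ennreal ((\<psi> x)\<^sup>2) \<partial>P) \<le> ennreal (c * exp_moment_const)"
  proof (rule noise_nn_integral_le[OF P pos])
    fix x
    define Y where "Y = (\<bar>x\<bar> / \<tau>) powr \<alpha>"
    show "(\<psi> x)\<^sup>2 \<le> c * exp (3 / 2 * (\<bar>x\<bar> / \<tau>) powr \<alpha>)"
    proof (cases "r > 1 \<and> \<bar>x\<bar> \<le> \<tau> * r")
      case False
      then have g: "1 \<le> exp 1 * (exp (- (r powr \<alpha>)) * exp Y)"
        unfolding Y_def using pos \<open>r \<ge> 0\<close> by (intro gate_le) (auto simp: field_simps)
      have x2: "x\<^sup>2 \<le> (\<tau> * k)\<^sup>2 * exp (1 / 2 * Y)"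
      proof -
        have "\<bar>x\<bar> / \<tau> \<le> k * exp (1 / 4 * Y)"
          unfolding k_def Y_def using pos by (intro le_exp_powr) auto
        then have "\<bar>x\<bar> \<le> \<tau> * k * exp (1 / 4 * Y)" using pos by (simp add: field_simps)
        then have "\<bar>x\<bar>\<^sup>2 \<le> (\<tau> * k * exp (1 / 4 * Y))\<^sup>2" by (intro power_mono) auto
        also have "\<dots> = (\<tau> * k)\<^sup>2 * exp (1 / 2 * Y)"
          by (simp add: power_mult_distrib exp_double[symmetric])
        finally show ?thesis by simp
      qed
      have "a\<^sup>2 * x\<^sup>2 * 1 \<le> a\<^sup>2 * x\<^sup>2 * (exp 1 * (exp (- (r powr \<alpha>)) * exp Y))"
        using g by (intro mult_left_mono) auto
      moreover have "(\<psi> x)\<^sup>2 \<le> a\<^sup>2 * x\<^sup>2 * 1"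
        using power_mono[OF \<psi>(1)[of x], of 2] by (simp add: power_mult_distrib)
      ultimately have "(\<psi> x)\<^sup>2 \<le> a\<^sup>2 * x\<^sup>2 * (exp 1 * (exp (- (r powr \<alpha>)) * exp Y))"
        by linarith
      also have "\<dots> \<le> a\<^sup>2 * ((\<tau> * k)\<^sup>2 * exp (1 / 2 * Y)) * (exp 1 * (exp (- (r powr \<alpha>)) * exp Y))"
        using x2 by (intro mult_right_mono mult_left_mono) auto
      also have "\<dots> = c * (exp (1 / 2 * Y) * exp Y)" by (simp add: c_def mult_ac)
      also have "exp (1 / 2 * Y) * exp Y = exp (3 / 2 * Y)" by (simp add: exp_add[symmetric])
      finally show ?thesis by (simp add: Y_def)
    qed (use \<psi>(2) in \<open>auto simp: c_def\<close>)
  qed (simp add: c_def)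
  also have "c * exp_moment_const = sq_const \<alpha> \<tau> * (a\<^sup>2 * exp (- (r powr \<alpha>)))" by (simp add: c_def sq_const_def k_def mult_ac)
  finally show ?thesis .
qed

section \<open>Moment generating functions of odd functions of the noise\<close>

lemma noise_odd_mgf_eq:
  assumes P: "P \<in> noise_class \<alpha> \<tau>" and [measurable]: "\<psi> \<in> borel_measurable borel"
    and odd: "\<And>x. \<psi> (- x) = - \<psi> x"
  shows "(\<integral>\<^sup>+ x. ennreal (exp (u * \<psi> x)) \<partial>P) = (\<integral>\<^sup>+ x. ennreal (cosh (u * \<psi> x)) \<partial>P)"
proof -
  have sets[measurable_cong]: "sets P = sets borel" using P by (simp add: noise_class_def)
  have sym: "distr P borel uminus = P" using P by (simp add: noise_class_def)
  let ?I = "\<integral>\<^sup>+ x. ennreal (exp (u * \<psi> x)) \<partial>P"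
  \<comment> \<open>Symmetry of the law and oddness of \<psi> allow \<open>u\<close> to be replaced
    by \<open>- u\<close>; the mean of both versions is the \<open>cosh\<close> integral.\<close>
  have "?I = (\<integral>\<^sup>+ x. ennreal (exp (u * \<psi> x)) \<partial>(distr P borel uminus))" by (simp only: sym)
  also have "\<dots> = (\<integral>\<^sup>+ x. ennreal (exp (- (u * \<psi> x))) \<partial>P)"
    by (subst nn_integral_distr) (auto simp: odd)
  finally have I: "?I = \<dots>" .
  have "2 * ?I = ?I + (\<integral>\<^sup>+ x. ennreal (exp (- (u * \<psi> x))) \<partial>P)" by (simp add: I[symmetric] mult_2)
  also have "\<dots> = (\<integral>\<^sup>+ x. ennreal (exp (u * \<psi> x)) + ennreal (exp (- (u * \<psi> x))) \<partial>P)"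
    by (subst nn_integral_add) auto
  also have "\<dots> = (\<integral>\<^sup>+ x. 2 * ennreal (cosh (u * \<psi> x)) \<partial>P)"
    by (intro nn_integral_cong)
      (simp add: cosh_field_def ennreal_plus[symmetric] ennreal_mult'[symmetric] del: ennreal_plus flip: ennreal_numeral)
  also have "\<dots> = 2 * (\<integral>\<^sup>+ x. ennreal (cosh (u * \<psi> x)) \<partial>P)"
    unfolding cosh_field_def by (intro nn_integral_cmult) measurable
  finally show ?thesis by (simp add: ennreal_mult_cancel_left)
qed

text \<open>Second-order Taylor expansion at \<open>y\<close> and at \<open>- y\<close>; the linear
  terms cancel in the mean.\<close>

lemma cosh_le_quadratic: "cosh (y::real) \<le> 1 + y\<^sup>2 * exp \<bar>y\<bar>"
proof -
  have e: "exp z \<le> 1 + z + z\<^sup>2 * exp \<bar>z\<bar>" for z :: real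
  proof -
    obtain t where t: "\<bar>t\<bar> \<le> \<bar>z\<bar>" "exp z = (\<Sum>m<2. z ^ m / fact m) + exp t / fact 2 * z ^ 2"
      using Maclaurin_exp_le[of z 2] by blast
    have "exp t \<le> exp \<bar>z\<bar>" using t(1) by simp
    then have "exp t / 2 \<le> exp \<bar>z\<bar>" using exp_gt_zero[of t] by linarith
    then have "exp t / fact 2 * z\<^sup>2 \<le> exp \<bar>z\<bar> * z\<^sup>2"
      by (intro mult_right_mono) auto
    then show ?thesis using t(2) by (simp add: numeral_2_eq_2 lessThan_Suc mult.commute)
  qed
  show ?thesis using e[of y] e[of "-y"] by (simp add: cosh_field_def)
qed

text \<open>One nonnegative summand for each of the three regimes in
  \<open>noise_odd_mgf_le\<close>, so that the sum dominates each of them.\<close>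

definition mgf_const :: "real \<Rightarrow> real \<Rightarrow> real" where
  "mgf_const \<alpha> \<tau> = exp \<tau> * sq_const \<alpha> \<tau> + exp 1 * (2 * exp (2 * \<tau>\<^sup>2 + 1 / 2) * exp_moment_const) + exp 1 * (ln exp_moment_const + 1 + \<tau>\<^sup>2)"

lemma sq_const_nonneg: "sq_const \<alpha> \<tau> \<ge> 0" using exp_moment_const_ge_1 by (simp add: sq_const_def)

lemma mgf_const_ge:
  "exp \<tau> * sq_const \<alpha> \<tau> \<le> mgf_const \<alpha> \<tau>" "exp 1 * (2 * exp (2 * \<tau>\<^sup>2 + 1 / 2) * exp_moment_const) \<le> mgf_const \<alpha> \<tau>"
  "exp 1 * (ln exp_moment_const + 1 + \<tau>\<^sup>2) \<le> mgf_const \<alpha> \<tau>" "mgf_const \<alpha> \<tau> \<ge> 0"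
proof -
  have "ln exp_moment_const \<ge> 0" using exp_moment_const_ge_1 by simp
  then have "0 \<le> exp 1 * (ln exp_moment_const + 1 + \<tau>\<^sup>2)" by simp
  moreover have "0 \<le> exp 1 * (2 * exp (2 * \<tau>\<^sup>2 + 1 / 2) * exp_moment_const)" using exp_moment_const_ge_1 by simp
  moreover have "0 \<le> exp \<tau> * sq_const \<alpha> \<tau>" using sq_const_nonneg by simp
  ultimately show "exp \<tau> * sq_const \<alpha> \<tau> \<le> mgf_const \<alpha> \<tau>" "exp 1 * (2 * exp (2 * \<tau>\<^sup>2 + 1 / 2) * exp_moment_const) \<le> mgf_const \<alpha> \<tau>"
    "exp 1 * (ln exp_moment_const + 1 + \<tau>\<^sup>2) \<le> mgf_const \<alpha> \<tau>" "mgf_const \<alpha> \<tau> \<ge> 0"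
    unfolding mgf_const_def by linarith+
qed

lemma sq_le_1_powr:
  fixes y \<alpha> :: real
  assumes "y \<ge> 0" "\<alpha> \<ge> 2"
  shows "y\<^sup>2 \<le> 1 + y powr \<alpha>"
proof (cases "y \<le> 1")
  case True
  then have "y\<^sup>2 \<le> 1" using assms by (simp add: power_le_one)
  then show ?thesis by (simp add: add_increasing2)
next
  case False
  then have "y powr 2 \<le> y powr \<alpha>" using assms by (intro powr_mono) auto
  then show ?thesis using False by simp
qed

text \<open>The factor \<open>exp (- (r powr \<alpha>))\<close> must survive in the exponent so that
  summing over coordinates produces \<open>u\<^sup>2 * B\<close>. If \<open>u * \<psi>\<close> is
  bounded by \<tau>, \<open>noise_sq_le\<close> suffices. Otherwise the tails are sub-Gaussian: for
  \<open>u * a \<le> 1\<close> they absorb \<open>exp \<bar>x\<bar>\<close>, and for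
  \<open>u * a > 1\<close> the hypothesis forces \<open>r \<le> 1\<close>, where the factor is at
  least \<open>exp (- 1)\<close>.\<close>

lemma noise_odd_mgf_le:
  assumes P: "P \<in> noise_class \<alpha> \<tau>" and pos: "\<alpha> > 0" "\<tau> > 0"
    and \<psi>m: "\<psi> \<in> borel_measurable borel" and odd: "\<And>x. \<psi> (- x) = - \<psi> x"
    and \<psi>: "\<And>x. \<bar>\<psi> x\<bar> \<le> a * \<bar>x\<bar>" "\<And>x. r > 1 \<Longrightarrow> \<bar>x\<bar> \<le> \<tau> * r \<Longrightarrow> \<psi> x = 0"
    and "a > 0" "r \<ge> 0" "u \<ge> 0"
    and cases: "(\<forall>x. \<bar>u * \<psi> x\<bar> \<le> \<tau>) \<or> (\<alpha> \<ge> 2 \<and> u * a * r \<le> 1)"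
  shows "(\<integral>\<^sup>+ x. ennreal (exp (u * \<psi> x)) \<partial>P) \<le> ennreal (exp (mgf_const \<alpha> \<tau> * (u\<^sup>2 * (a\<^sup>2 * exp (- (r powr \<alpha>))))))"
proof -
  interpret prob_space P using P by (simp add: noise_class_def)
  have sets[measurable_cong]: "sets P = sets borel" using P by (simp add: noise_class_def)
  note \<psi>m[measurable]
  define w where "w = u\<^sup>2 * (a\<^sup>2 * exp (- (r powr \<alpha>)))"
  have w0: "w \<ge> 0" by (simp add: w_def)
  have K: "ennreal (1 + k * w) \<le> ennreal (exp (mgf_const \<alpha> \<tau> * w))" if "k \<le> mgf_const \<alpha> \<tau>" for k
  proof -
    have "1 + k * w \<le> exp (k * w)" by (rule exp_ge_add_one_self)
    also have "\<dots> \<le> exp (mgf_const \<alpha> \<tau> * w)" using that w0 by (simp add: mult_right_mono)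
    finally show ?thesis by (rule ennreal_leI)
  qed
  have cosh_int: "(\<integral>\<^sup>+ x. ennreal (cosh (u * \<psi> x)) \<partial>P) \<le> ennreal (1 + k)"
    if "\<And>x. cosh (u * \<psi> x) \<le> 1 + f x" "(\<integral>\<^sup>+ x. ennreal (f x) \<partial>P) \<le> ennreal k" "k \<ge> 0"
      "f \<in> borel_measurable borel" "\<And>x. f x \<ge> 0" for f k
  proof -
    note that(4)[measurable]
    have "(\<integral>\<^sup>+ x. ennreal (cosh (u * \<psi> x)) \<partial>P) \<le> (\<integral>\<^sup>+ x. 1 + ennreal (f x) \<partial>P)"
      using that by (intro nn_integral_mono) (metis ennreal_1 ennreal_leI ennreal_plus zero_le_one)
    also have "\<dots> = 1 + (\<integral>\<^sup>+ x. ennreal (f x) \<partial>P)"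
      by (subst nn_integral_add) (auto simp: emeasure_space_1)
    also have "\<dots> \<le> 1 + ennreal k" using that by (intro add_left_mono)
    finally show ?thesis using that by simp
  qed
  have ab: "\<bar>u * \<psi> x\<bar> \<le> u * a * \<bar>x\<bar>" for x
    using mult_left_mono[OF \<psi>(1)[of x] \<open>u \<ge> 0\<close>] \<open>u \<ge> 0\<close> by (simp add: abs_mult mult.assoc)
  have "(\<integral>\<^sup>+ x. ennreal (cosh (u * \<psi> x)) \<partial>P) \<le> ennreal (exp (mgf_const \<alpha> \<tau> * w))"
  proof (cases "\<forall>x. \<bar>u * \<psi> x\<bar> \<le> \<tau>")
    case True
    have "(\<integral>\<^sup>+ x. ennreal (cosh (u * \<psi> x)) \<partial>P) \<le> ennreal (1 + exp \<tau> * sq_const \<alpha> \<tau> * w)"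
    proof (rule cosh_int[of "\<lambda>x. (exp \<tau> * u\<^sup>2) * (\<psi> x)\<^sup>2"])
      show "cosh (u * \<psi> x) \<le> 1 + exp \<tau> * u\<^sup>2 * (\<psi> x)\<^sup>2" for x
      proof -
        have "(u * \<psi> x)\<^sup>2 * exp \<bar>u * \<psi> x\<bar> \<le> (u * \<psi> x)\<^sup>2 * exp \<tau>"
          using True by (intro mult_left_mono) auto
        then show ?thesis using cosh_le_quadratic[of "u * \<psi> x"] by (simp add: power_mult_distrib mult_ac)
      qed
      have "(\<integral>\<^sup>+ x. ennreal (exp \<tau> * u\<^sup>2 * (\<psi> x)\<^sup>2) \<partial>P) = ennreal (exp \<tau> * u\<^sup>2) * (\<integral>\<^sup>+ x. ennreal ((\<psi> x)\<^sup>2) \<partial>P)"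
        by (subst nn_integral_cmult[symmetric]) (auto simp: ennreal_mult[symmetric])
      also have "\<dots> \<le> ennreal (exp \<tau> * u\<^sup>2) * ennreal (sq_const \<alpha> \<tau> * (a\<^sup>2 * exp (- (r powr \<alpha>))))"
        by (intro mult_left_mono noise_sq_le[OF P pos \<psi>] assms) auto
      also have "\<dots> = ennreal (exp \<tau> * sq_const \<alpha> \<tau> * w)"
        using sq_const_nonneg by (simp add: ennreal_mult[symmetric] w_def mult_ac)
      finally show "(\<integral>\<^sup>+ x. ennreal (exp \<tau> * u\<^sup>2 * (\<psi> x)\<^sup>2) \<partial>P) \<le> ennreal (exp \<tau> * sq_const \<alpha> \<tau> * w)" .
    qed (use sq_const_nonneg w0 in auto)
    also have "\<dots> \<le> ennreal (exp (mgf_const \<alpha> \<tau> * w))" by (intro K mgf_const_ge)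
    finally show ?thesis .
  next
    case False
    with cases have al: "\<alpha> \<ge> 2" and uar: "u * a * r \<le> 1" by auto
    have sq: "(\<bar>x\<bar> / \<tau>)\<^sup>2 \<le> 1 + (\<bar>x\<bar> / \<tau>) powr \<alpha>" for x
      using pos al by (intro sq_le_1_powr) auto
    show ?thesis
    proof (cases "u * a \<le> 1")
      case True
      define c where "c = exp 1 * (2 * exp (2 * \<tau>\<^sup>2 + 1 / 2)) * w"
      define f where "f = (\<lambda>x. (u * \<psi> x)\<^sup>2 * exp \<bar>u * \<psi> x\<bar>)"
      have "(\<integral>\<^sup>+ x. ennreal (cosh (u * \<psi> x)) \<partial>P) \<le> ennreal (1 + c * exp_moment_const)"
      proof (rule cosh_int[of f])
        show "(\<integral>\<^sup>+ x. ennreal (f x) \<partial>P) \<le> ennreal (c * exp_moment_const)"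
        proof (rule noise_nn_integral_le[OF P pos])
          fix x
          define Y where "Y = (\<bar>x\<bar> / \<tau>) powr \<alpha>"
          show "f x \<le> c * exp (3 / 2 * (\<bar>x\<bar> / \<tau>) powr \<alpha>)"
          proof (cases "r > 1 \<and> \<bar>x\<bar> \<le> \<tau> * r")
            case False
            then have g: "1 \<le> exp 1 * (exp (- (r powr \<alpha>)) * exp Y)"
              unfolding Y_def using pos \<open>r \<ge> 0\<close> by (intro gate_le) (auto simp: field_simps)
            have "(u * \<psi> x)\<^sup>2 \<le> (u * a * \<bar>x\<bar>)\<^sup>2"
              using power_mono[OF ab[of x], of 2] by simp
            moreover have "\<bar>u * \<psi> x\<bar> \<le> \<bar>x\<bar>"
              using ab[of x] True mult_right_mono[of "u * a" 1 "\<bar>x\<bar>"] by simp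
            ultimately have "f x \<le> (u * a * \<bar>x\<bar>)\<^sup>2 * exp \<bar>x\<bar>"
              unfolding f_def by (intro mult_mono) auto
            also have "\<dots> = (u * a)\<^sup>2 * (x\<^sup>2 * exp \<bar>x\<bar>)" by (simp add: power_mult_distrib mult_ac)
            also have "\<dots> \<le> (u * a)\<^sup>2 * (2 * exp (2 * \<tau>\<^sup>2 + 1 / 2) * exp (1 / 2 * Y))"
            proof (intro mult_left_mono)
              have "x\<^sup>2 \<le> 2 * exp \<bar>x\<bar>"
                using exp_lower_Taylor_quadratic[of "\<bar>x\<bar>"] by simp
              then have "x\<^sup>2 * exp \<bar>x\<bar> \<le> 2 * exp \<bar>x\<bar> * exp \<bar>x\<bar>" by (intro mult_right_mono) auto
              also have "\<dots> = 2 * exp (2 * \<bar>x\<bar>)" by (simp add: exp_double power2_eq_square)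
              also have "2 * \<bar>x\<bar> \<le> 2 * \<tau>\<^sup>2 + 1 / 2 + 1 / 2 * Y"
              proof -
                \<comment> \<open>Completing the square trades the linear exponent for a quarter of
                  \<open>(\<bar>x\<bar> / \<tau>)\<^sup>2\<close>, which is at most a quarter of
                  \<open>1 + Y\<close>.\<close>
                have "0 \<le> (\<bar>x\<bar> / \<tau> - 2 * \<tau>)\<^sup>2" by simp
                then have "4 * \<bar>x\<bar> \<le> (\<bar>x\<bar> / \<tau>)\<^sup>2 + 4 * \<tau>\<^sup>2"
                  using pos by (simp add: power2_diff power_mult_distrib)
                then show ?thesis using sq[of x] by (simp add: Y_def)
              qed
              then have "2 * exp (2 * \<bar>x\<bar>) \<le> 2 * exp (2 * \<tau>\<^sup>2 + 1 / 2 + 1 / 2 * Y)" by simp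
              finally show "x\<^sup>2 * exp \<bar>x\<bar> \<le> 2 * exp (2 * \<tau>\<^sup>2 + 1 / 2) * exp (1 / 2 * Y)"
                by (simp add: exp_add)
            qed auto
            also have "\<dots> \<le> (u * a)\<^sup>2 * (2 * exp (2 * \<tau>\<^sup>2 + 1 / 2) * exp (1 / 2 * Y))
                * (exp 1 * (exp (- (r powr \<alpha>)) * exp Y))"
              using mult_left_mono[OF g, of "(u * a)\<^sup>2 * (2 * exp (2 * \<tau>\<^sup>2 + 1 / 2) * exp (1 / 2 * Y))"] by simp
            also have "\<dots> = c * (exp (1 / 2 * Y) * exp Y)" by (simp add: c_def w_def power_mult_distrib mult_ac)
            also have "exp (1 / 2 * Y) * exp Y = exp (3 / 2 * Y)" by (simp add: exp_add[symmetric])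
            finally show ?thesis by (simp add: Y_def)
          qed (use \<psi>(2) w0 in \<open>auto simp: c_def f_def\<close>)
        qed (use w0 in \<open>simp add: c_def\<close>)
      qed (use exp_moment_const_ge_1 w0 cosh_le_quadratic in \<open>auto simp: c_def f_def\<close>)
      also have "c * exp_moment_const = exp 1 * (2 * exp (2 * \<tau>\<^sup>2 + 1 / 2) * exp_moment_const) * w" by (simp add: c_def mult_ac)
      also have "ennreal (1 + exp 1 * (2 * exp (2 * \<tau>\<^sup>2 + 1 / 2) * exp_moment_const) * w) \<le> ennreal (exp (mgf_const \<alpha> \<tau> * w))"
        by (intro K mgf_const_ge)
      finally show ?thesis .
    next
      case False
      define v where "v = u * a"
      have v: "v > 1" using False by (simp add: v_def)
      \<comment> \<open>Here \<open>v > 1\<close> and \<open>v * r \<le> 1\<close>, so the threshold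
        ratio is at most 1.\<close>
      have "r \<le> v * r" using v \<open>r \<ge> 0\<close> by (simp add: mult_le_cancel_right1)
      then have "r \<le> 1" using uar by (simp add: v_def)
      then have "r powr \<alpha> \<le> 1" using \<open>r \<ge> 0\<close> pos by (intro powr_le1) auto
      have "(\<integral>\<^sup>+ x. ennreal (cosh (u * \<psi> x)) \<partial>P) \<le> ennreal (exp (1 + v\<^sup>2 * \<tau>\<^sup>2) * exp_moment_const)"
      proof (rule noise_nn_integral_le[OF P pos])
        fix x
        define Y where "Y = (\<bar>x\<bar> / \<tau>) powr \<alpha>"
        have Y0: "Y \<ge> 0" by (simp add: Y_def)
        have "cosh (u * \<psi> x) \<le> exp \<bar>u * \<psi> x\<bar>"
          by (cases "u * \<psi> x \<ge> 0") (auto simp: cosh_field_def)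
        also have "\<bar>u * \<psi> x\<bar> \<le> 1 + v\<^sup>2 * \<tau>\<^sup>2 + 3 / 2 * Y"
        proof -
          have "0 \<le> (\<bar>x\<bar> / \<tau> - v * \<tau>)\<^sup>2" by simp
          then have "2 * (v * \<bar>x\<bar>) \<le> (\<bar>x\<bar> / \<tau>)\<^sup>2 + v\<^sup>2 * \<tau>\<^sup>2"
            using pos by (simp add: power2_diff power_mult_distrib mult_ac)
          moreover have "0 \<le> v * \<bar>x\<bar>" using v by simp
          ultimately show ?thesis using sq[of x] ab[of x] Y0 unfolding Y_def[symmetric] v_def[symmetric] mult.assoc[of v] by linarith
        qed
        then have "exp \<bar>u * \<psi> x\<bar> \<le> exp (1 + v\<^sup>2 * \<tau>\<^sup>2 + 3 / 2 * Y)" by simp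
        finally show "cosh (u * \<psi> x) \<le> exp (1 + v\<^sup>2 * \<tau>\<^sup>2) * exp (3 / 2 * (\<bar>x\<bar> / \<tau>) powr \<alpha>)"
          by (simp add: exp_add Y_def)
      qed simp
      also have "exp (1 + v\<^sup>2 * \<tau>\<^sup>2) * exp_moment_const = exp (ln exp_moment_const + (1 + v\<^sup>2 * \<tau>\<^sup>2))"
        using exp_moment_const_ge_1 by (simp add: exp_add mult.commute)
      also have "ln exp_moment_const + (1 + v\<^sup>2 * \<tau>\<^sup>2) \<le> mgf_const \<alpha> \<tau> * w"
      proof -
        \<comment> \<open>Since \<open>v\<^sup>2 \<ge> 1\<close>, the additive constants can be made
          proportional to \<open>v\<^sup>2\<close>; the missing factor is then restored through
          \<open>exp (1 - r powr \<alpha>) \<ge> 1\<close>.\<close>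
        have v2: "v\<^sup>2 \<ge> 1" using v by (simp add: one_le_power)
        have "ln exp_moment_const \<ge> 0" using exp_moment_const_ge_1 by simp
        have "ln exp_moment_const + 1 \<le> v\<^sup>2 * (ln exp_moment_const + 1)" using v2 \<open>ln exp_moment_const \<ge> 0\<close> mult_right_mono[of 1 "v\<^sup>2" "ln exp_moment_const + 1"] by simp
        then have "ln exp_moment_const + (1 + v\<^sup>2 * \<tau>\<^sup>2) \<le> v\<^sup>2 * (ln exp_moment_const + 1 + \<tau>\<^sup>2)" by (simp add: algebra_simps)
        also have "\<dots> \<le> v\<^sup>2 * (ln exp_moment_const + 1 + \<tau>\<^sup>2) * exp (1 - r powr \<alpha>)"
        proof -
          have "1 \<le> exp (1 - r powr \<alpha>)" using \<open>r powr \<alpha> \<le> 1\<close> by simp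
          moreover have "0 \<le> v\<^sup>2 * (ln exp_moment_const + 1 + \<tau>\<^sup>2)" using \<open>ln exp_moment_const \<ge> 0\<close> by simp
          ultimately show ?thesis using mult_left_mono[of 1 "exp (1 - r powr \<alpha>)" "v\<^sup>2 * (ln exp_moment_const + 1 + \<tau>\<^sup>2)"] by simp
        qed
        also have "\<dots> = exp 1 * (ln exp_moment_const + 1 + \<tau>\<^sup>2) * w"
          by (simp add: w_def v_def power_mult_distrib exp_diff exp_minus divide_inverse mult_ac)
        also have "\<dots> \<le> mgf_const \<alpha> \<tau> * w" using mgf_const_ge w0 by (intro mult_right_mono) auto
        finally show ?thesis .
      qed
      then have "ennreal (exp (ln exp_moment_const + (1 + v\<^sup>2 * \<tau>\<^sup>2))) \<le> ennreal (exp (mgf_const \<alpha> \<tau> * w))"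
        by (intro ennreal_leI) simp
      finally show ?thesis .
    qed
  qed
  then show ?thesis unfolding noise_odd_mgf_eq[OF P \<psi>m odd] w_def .
qed

section \<open>Sums of independent noise\<close>

text \<open>Averaging the squares of \<open>c + \<psi> x\<close> and \<open>c - \<psi> x\<close>
  removes the cross term. Later \<open>c\<close> is the sum of the other coordinates, so this is
  additivity of variances for nonnegative integrals.\<close>

lemma noise_odd_shift_sq:
  assumes P: "P \<in> noise_class \<alpha> \<tau>" and [measurable]: "\<psi> \<in> borel_measurable borel"
    and odd: "\<And>x. \<psi> (- x) = - \<psi> x"
  shows "(\<integral>\<^sup>+ x. ennreal ((c + \<psi> x)\<^sup>2) \<partial>P) = ennreal (c\<^sup>2) + (\<integral>\<^sup>+ x. ennreal ((\<psi> x)\<^sup>2) \<partial>P)"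
proof -
  interpret prob_space P using P by (simp add: noise_class_def)
  have sets[measurable_cong]: "sets P = sets borel" using P by (simp add: noise_class_def)
  have sym: "distr P borel uminus = P" using P by (simp add: noise_class_def)
  let ?I = "\<integral>\<^sup>+ x. ennreal ((c + \<psi> x)\<^sup>2) \<partial>P"
  have "?I = (\<integral>\<^sup>+ x. ennreal ((c + \<psi> x)\<^sup>2) \<partial>(distr P borel uminus))" by (simp only: sym)
  also have "\<dots> = (\<integral>\<^sup>+ x. ennreal ((c - \<psi> x)\<^sup>2) \<partial>P)"
    by (subst nn_integral_distr) (auto simp: odd)
  finally have I: "?I = \<dots>" .
  have "2 * ?I = ?I + (\<integral>\<^sup>+ x. ennreal ((c - \<psi> x)\<^sup>2) \<partial>P)" by (simp add: I[symmetric] mult_2)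
  also have "\<dots> = (\<integral>\<^sup>+ x. ennreal ((c + \<psi> x)\<^sup>2) + ennreal ((c - \<psi> x)\<^sup>2) \<partial>P)"
    by (subst nn_integral_add) auto
  also have "\<dots> = (\<integral>\<^sup>+ x. 2 * (ennreal (c\<^sup>2) + ennreal ((\<psi> x)\<^sup>2)) \<partial>P)"
  proof (intro nn_integral_cong)
    fix x
    have "(c + \<psi> x)\<^sup>2 + (c - \<psi> x)\<^sup>2 = 2 * (c\<^sup>2 + (\<psi> x)\<^sup>2)" by (simp add: power2_eq_square algebra_simps)
    then have "ennreal ((c + \<psi> x)\<^sup>2) + ennreal ((c - \<psi> x)\<^sup>2) = ennreal (2 * (c\<^sup>2 + (\<psi> x)\<^sup>2))"
      by (subst ennreal_plus[symmetric]) auto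
    then show "ennreal ((c + \<psi> x)\<^sup>2) + ennreal ((c - \<psi> x)\<^sup>2) = 2 * (ennreal (c\<^sup>2) + ennreal ((\<psi> x)\<^sup>2))"
      by (simp add: ennreal_mult)
  qed
  also have "\<dots> = 2 * (ennreal (c\<^sup>2) + (\<integral>\<^sup>+ x. ennreal ((\<psi> x)\<^sup>2) \<partial>P))"
    by (subst nn_integral_cmult, measurable) (simp add: nn_integral_add emeasure_space_1)
  finally show ?thesis by (subst (asm) ennreal_mult_cancel_left) simp
qed

text \<open>The locale \<open>product_prob_space\<close> wants a probability measure at every index;
  point masses fill the indices outside \<open>I\<close>.\<close>

lemma PiM_extend_prob:
  assumes "\<And>j. j \<in> I \<Longrightarrow> prob_space (P j)"
  obtains P' where "product_prob_space P'" "\<And>j. j \<in> I \<Longrightarrow> P' j = P j" "\<And>J. J \<subseteq> I \<Longrightarrow> Pi\<^sub>M J P' = Pi\<^sub>M J P"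
proof
  define P' where "P' = (\<lambda>j. if j \<in> I then P j else return (count_space UNIV) undefined)"
  have ps: "prob_space (P' j)" for j
    using assms by (auto simp: P'_def intro!: prob_space_return)
  then interpret prob_space "P' j" for j .
  show "product_prob_space P'" by standard
  show "P' j = P j" if "j \<in> I" for j using that by (simp add: P'_def)
  show "Pi\<^sub>M J P' = Pi\<^sub>M J P" if "J \<subseteq> I" for J using that by (intro PiM_cong) (auto simp: P'_def)
qed

text \<open>Induction on the index set: Fubini integrates the new coordinate first, with the partial
  sum as the shift in \<open>noise_odd_shift_sq\<close>.\<close>

lemma noise_sum_sq_le:
  assumes noise: "\<And>j. j \<in> I \<Longrightarrow> P j \<in> noise_class \<alpha> \<tau>" and "finite I"
    and m: "\<And>j. j \<in> I \<Longrightarrow> \<psi> j \<in> borel_measurable borel"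
    and odd: "\<And>j x. j \<in> I \<Longrightarrow> \<psi> j (- x) = - \<psi> j x"
    and v: "\<And>j. j \<in> I \<Longrightarrow> (\<integral>\<^sup>+ x. ennreal ((\<psi> j x)\<^sup>2) \<partial>P j) \<le> ennreal (v j)" "\<And>j. j \<in> I \<Longrightarrow> v j \<ge> 0"
  shows "(\<integral>\<^sup>+ x. ennreal ((\<Sum>j\<in>I. \<psi> j (x j))\<^sup>2) \<partial>Pi\<^sub>M I P) \<le> ennreal (\<Sum>j\<in>I. v j)"
proof -
  have "prob_space (P j)" if "j \<in> I" for j using noise[OF that] by (simp add: noise_class_def)
  then obtain P' where P': "product_prob_space P'" "\<And>j. j \<in> I \<Longrightarrow> P' j = P j" "\<And>J. J \<subseteq> I \<Longrightarrow> Pi\<^sub>M J P' = Pi\<^sub>M J P"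
    using PiM_extend_prob[of I P] by metis
  interpret product_prob_space P' by (rule P')
  have sets: "sets (P' j) = sets borel" if "j \<in> I" for j
    using noise[OF that] P'(2)[OF that] by (simp add: noise_class_def)
  have m': "\<psi> j \<in> borel_measurable (P' j)" if "j \<in> I" for j
    using m[OF that] sets[OF that] by (simp cong: measurable_cong_sets)
  have "(\<integral>\<^sup>+ x. ennreal ((\<Sum>j\<in>J. \<psi> j (x j))\<^sup>2) \<partial>Pi\<^sub>M J P') \<le> ennreal (\<Sum>j\<in>J. v j)" if "J \<subseteq> I" for J
    using finite_subset[OF that \<open>finite I\<close>] that
  proof (induction J rule: finite_induct)
    case empty
    then show ?case by simp
  next
    case (insert i J)
    have [measurable]: "\<psi> j \<in> borel_measurable (P' j)" if "j \<in> insert i J" for j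
      using m' that insert.prems by auto
    have iI: "i \<in> I" using insert.prems by auto
    have sm[measurable]: "(\<lambda>x. \<Sum>j\<in>J. \<psi> j (x j)) \<in> borel_measurable (Pi\<^sub>M J P')"
      by measurable
    interpret J: prob_space "Pi\<^sub>M J P'" by (intro prob_space_PiM prob_space)
    have "(\<integral>\<^sup>+ x. ennreal ((\<Sum>j\<in>insert i J. \<psi> j (x j))\<^sup>2) \<partial>Pi\<^sub>M (insert i J) P')
        = (\<integral>\<^sup>+ x. \<integral>\<^sup>+ y. ennreal ((\<Sum>j\<in>insert i J. \<psi> j ((x(i := y)) j))\<^sup>2) \<partial>P' i \<partial>Pi\<^sub>M J P')"
      using insert.hyps by (intro product_nn_integral_insert) (auto, measurable)
    also have "\<dots> = (\<integral>\<^sup>+ x. \<integral>\<^sup>+ y. ennreal (((\<Sum>j\<in>J. \<psi> j (x j)) + \<psi> i y)\<^sup>2) \<partial>P' i \<partial>Pi\<^sub>M J P')"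
    proof (intro nn_integral_cong arg_cong[of _ _ ennreal] arg_cong[of _ _ "\<lambda>x. x\<^sup>2"])
      fix x :: "'a \<Rightarrow> real" and y :: real
      have "(\<Sum>j\<in>J. \<psi> j ((x(i := y)) j)) = (\<Sum>j\<in>J. \<psi> j (x j))"
        using insert.hyps by (intro sum.cong) auto
      then show "(\<Sum>j\<in>insert i J. \<psi> j ((x(i := y)) j)) = (\<Sum>j\<in>J. \<psi> j (x j)) + \<psi> i y"
        using insert.hyps by (simp add: add.commute)
    qed
    also have "\<dots> = (\<integral>\<^sup>+ x. ennreal ((\<Sum>j\<in>J. \<psi> j (x j))\<^sup>2) + (\<integral>\<^sup>+ x. ennreal ((\<psi> i x)\<^sup>2) \<partial>P i) \<partial>Pi\<^sub>M J P')"
      unfolding P'(2)[OF iI]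
      by (intro nn_integral_cong noise_odd_shift_sq[OF noise[OF iI]] m odd iI)
    also have "\<dots> = (\<integral>\<^sup>+ x. ennreal ((\<Sum>j\<in>J. \<psi> j (x j))\<^sup>2) \<partial>Pi\<^sub>M J P') + (\<integral>\<^sup>+ x. ennreal ((\<psi> i x)\<^sup>2) \<partial>P i)"
      by (subst nn_integral_add) (auto simp: J.emeasure_space_1)
    also have "\<dots> \<le> ennreal (\<Sum>j\<in>J. v j) + ennreal (v i)"
      using insert v iI by (intro add_mono) auto
    also have "\<dots> = ennreal (\<Sum>j\<in>insert i J. v j)"
      using insert v iI by (subst ennreal_plus[symmetric]) (auto intro!: sum_nonneg simp: add.commute)
    finally show ?case .
  qed
  from this[of I] show ?thesis using P'(3)[of I] by simp
qed

lemma noise_sum_mgf_le: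
  fixes w :: "'i \<Rightarrow> real"
  assumes noise: "\<And>j. j \<in> I \<Longrightarrow> P j \<in> noise_class \<alpha> \<tau>" and "finite I"
    and m: "\<And>j. j \<in> I \<Longrightarrow> \<psi> j \<in> borel_measurable borel"
    and w: "\<And>j. j \<in> I \<Longrightarrow> (\<integral>\<^sup>+ x. ennreal (exp (u * \<psi> j x)) \<partial>P j) \<le> ennreal (exp (w j))"
  shows "(\<integral>\<^sup>+ x. ennreal (exp (u * (\<Sum>j\<in>I. \<psi> j (x j)))) \<partial>Pi\<^sub>M I P) \<le> ennreal (exp (\<Sum>j\<in>I. w j))"
proof -
  have "prob_space (P j)" if "j \<in> I" for j using noise[OF that] by (simp add: noise_class_def)
  then obtain P' where P': "product_prob_space P'" "\<And>j. j \<in> I \<Longrightarrow> P' j = P j" "\<And>J. J \<subseteq> I \<Longrightarrow> Pi\<^sub>M J P' = Pi\<^sub>M J P"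
    using PiM_extend_prob[of I P] by metis
  interpret product_prob_space P' by (rule P')
  have sets: "sets (P' j) = sets borel" if "j \<in> I" for j
    using noise[OF that] P'(2)[OF that] by (simp add: noise_class_def)
  have "(\<integral>\<^sup>+ x. ennreal (exp (u * (\<Sum>j\<in>I. \<psi> j (x j)))) \<partial>Pi\<^sub>M I P')
      = (\<integral>\<^sup>+ x. (\<Prod>j\<in>I. ennreal (exp (u * \<psi> j (x j)))) \<partial>Pi\<^sub>M I P')"
    using \<open>finite I\<close> by (simp add: prod_ennreal exp_sum sum_distrib_left)
  also have "\<dots> = (\<Prod>j\<in>I. \<integral>\<^sup>+ x. ennreal (exp (u * \<psi> j x)) \<partial>P' j)"
  proof (rule product_nn_integral_prod[OF \<open>finite I\<close>])
    fix j assume j: "j \<in> I"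
    note m[OF j, measurable]
    have "(\<lambda>x. ennreal (exp (u * \<psi> j x))) \<in> borel_measurable borel" by measurable
    then show "(\<lambda>x. ennreal (exp (u * \<psi> j x))) \<in> borel_measurable (P' j)"
      using sets[OF j] by (simp cong: measurable_cong_sets)
  qed
  also have "\<dots> \<le> (\<Prod>j\<in>I. ennreal (exp (w j)))"
    using w P'(2) by (intro prod_mono_ennreal) auto
  also have "\<dots> = ennreal (exp (\<Sum>j\<in>I. w j))"
    using \<open>finite I\<close> by (simp add: prod_ennreal exp_sum)
  finally show ?thesis using P'(3)[of I] by simp
qed

text \<open>With \<open>y = u * \<bar>X\<bar>\<close>, the square costs
  \<open>8 * exp (y / 2)\<close>. Half of the exponent remains for the deviation factor
  \<open>exp (- u * x / 2)\<close>.\<close>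

lemma sq_indicator_le_cosh:
  fixes X x u :: real
  assumes "u > 0" "\<bar>X\<bar> > x"
  shows "X\<^sup>2 \<le> 8 / u\<^sup>2 * exp (- u * x / 2) * (exp (u * X) + exp (- u * X))"
proof -
  define y where "y = u * \<bar>X\<bar>"
  have y: "y \<ge> 0" using assms by (simp add: y_def)
  have "(y / 2)\<^sup>2 / 2 \<le> exp (y / 2)"
    using exp_lower_Taylor_quadratic[of "y / 2"] y by simp
  then have "y\<^sup>2 \<le> 8 * exp (y / 2)" by (simp add: power_divide)
  also have "exp (y / 2) = exp (- y / 2) * exp y" by (simp add: exp_add[symmetric])
  also have "exp (- y / 2) \<le> exp (- u * x / 2)"
    using assms mult_left_mono[of x "\<bar>X\<bar>" u] by (simp add: y_def)
  also have "exp y \<le> exp (u * X) + exp (- u * X)"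
    by (cases "X \<ge> 0") (auto simp: y_def)
  finally have "y\<^sup>2 \<le> 8 * (exp (- u * x / 2) * (exp (u * X) + exp (- u * X)))"
    by simp
  then show ?thesis using assms by (simp add: y_def power_mult_distrib field_simps)
qed

section \<open>Threshold estimators\<close>

text \<open>The estimators are studied at noise level 1; the general level is recovered by
  scaling.\<close>

locale loss_noise = loss +
  fixes \<tau> :: real and P :: "nat \<Rightarrow> real measure"
  assumes tau_pos: "\<tau> > 0" and noise: "\<And>j. j \<in> {1..d} \<Longrightarrow> P j \<in> noise_class \<alpha> \<tau>"
begin

abbreviation Q :: "(nat \<Rightarrow> real) measure" where
  "Q \<equiv> Pi\<^sub>M {1..d} P"

sublocale Q: prob_space Q
  using noise by (intro prob_space_PiM) (simp add: noise_class_def)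

lemma sets_noise [measurable_cong]: "j \<in> {1..d} \<Longrightarrow> sets (P j) = sets borel"
  using noise by (simp add: noise_class_def)

lemma component_measurable [measurable]: "j \<in> {1..d} \<Longrightarrow> (\<lambda>x. x j) \<in> borel_measurable Q"
  using measurable_component_singleton[of j "{1..d}" P] sets_noise[of j]
  by (simp cong: measurable_cong_sets)

section \<open>Coordinatewise form of the estimators\<close>

definition h :: "real \<Rightarrow> nat \<Rightarrow> real \<Rightarrow> real" where
  "h t j z = (if \<bar>\<eta> j\<bar> \<ge> lam t \<or> \<bar>z\<bar> > \<tau> * lam t then z else 0)"

lemma h_measurable [measurable]: "h t j \<in> borel_measurable borel"
  unfolding h_def by measurable

text \<open>Because the coefficients are sorted, those reaching the threshold form an initial
  segment, so the split by index is a condition on each coordinate alone.\<close>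

lemma le_j2_iff:
  assumes "j \<in> {1..d}"
  shows "j \<le> j2 \<alpha> d \<eta> t \<longleftrightarrow> lam t \<le> \<bar>\<eta> j\<bar>"
proof
  assume j: "j \<le> j2 \<alpha> d \<eta> t"
  have "j2 \<alpha> d \<eta> t \<in> insert 0 {j \<in> {1..d}. \<bar>\<eta> j\<bar> \<ge> lam t}"
    unfolding j2_def by (intro Max_in) auto
  then have "lam t \<le> \<bar>\<eta> (j2 \<alpha> d \<eta> t)\<bar>" "j2 \<alpha> d \<eta> t \<le> d" using j assms by auto
  then show "lam t \<le> \<bar>\<eta> j\<bar>" using eta_antimono[of j "j2 \<alpha> d \<eta> t"] j assms by auto
next
  assume "lam t \<le> \<bar>\<eta> j\<bar>"
  then show "j \<le> j2 \<alpha> d \<eta> t" unfolding j2_def using assms by (intro Max_ge) auto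
qed

lemma j2_le: "j2 \<alpha> d \<eta> t \<le> d"
  by (auto simp: j2_def)

lemma L_hat_eq: "L_hat \<alpha> \<tau> d \<eta> 1 t y = (\<Sum>j=1..d. h (real t) j (\<eta> j * y j))"
proof -
  have "(\<Sum>j=1..d. h t j (\<eta> j * y j)) = (\<Sum>j\<in>{1..j2 \<alpha> d \<eta> t} \<union> {j2 \<alpha> d \<eta> t<..d}. h t j (\<eta> j * y j))"
    using j2_le[of t] by (intro sum.cong) auto
  also have "\<dots> = (\<Sum>j\<in>{1..j2 \<alpha> d \<eta> t}. h t j (\<eta> j * y j)) + (\<Sum>j\<in>{j2 \<alpha> d \<eta> t<..d}. h t j (\<eta> j * y j))"
    by (intro sum.union_disjoint) auto
  also have "\<dots> = L_hat \<alpha> \<tau> d \<eta> 1 t y"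
    unfolding L_hat_def
  proof (intro arg_cong2[of _ _ _ _ "(+)"] sum.cong refl)
    fix j assume "j \<in> {1..j2 \<alpha> d \<eta> t}"
    then show "h t j (\<eta> j * y j) = \<eta> j * y j"
      using le_j2_iff[of j t] j2_le[of t] by (simp add: h_def)
  next
    fix j assume "j \<in> {j2 \<alpha> d \<eta> t<..d}"
    then have "\<not> lam t \<le> \<bar>\<eta> j\<bar>" using le_j2_iff[of j t] by auto
    then show "h t j (\<eta> j * y j) = \<eta> j * y j * (if \<bar>\<eta> j * y j\<bar> > 1 * \<tau> * lam t then 1 else 0)"
      by (simp add: h_def)
  qed
  finally show ?thesis by simp
qed

lemma L_hat_measurable [measurable]:
  "(\<lambda>\<xi>. L_hat \<alpha> \<tau> d \<eta> 1 t (\<lambda>j. \<theta> j + \<xi> j)) \<in> borel_measurable Q"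
  unfolding L_hat_eq by measurable

text \<open>What the lower threshold of level \<open>t'\<close> retains and the higher one of level
  \<open>t\<close> discards. It is odd in \<open>z\<close>, bounded by
  \<open>\<tau> * lam t\<close>, and vanishes below the lower threshold for small
  coefficients.\<close>

definition g :: "real \<Rightarrow> real \<Rightarrow> nat \<Rightarrow> real \<Rightarrow> real" where
  "g t t' j z = (if \<bar>\<eta> j\<bar> < lam t \<and> \<bar>z\<bar> \<le> \<tau> * lam t \<and> (\<bar>\<eta> j\<bar> \<ge> lam t' \<or> \<bar>z\<bar> > \<tau> * lam t') then z else 0)"

lemma g_measurable [measurable]: "g t t' j \<in> borel_measurable borel"
  unfolding g_def by measurable

lemma h_diff:
  assumes "1 \<le> t" "t \<le> t'"
  shows "h t j z - h t' j z = - g t t' j z"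
proof -
  have "lam t' \<le> lam t" using assms by (rule lam_antimono)
  moreover have "\<tau> * lam t' \<le> \<tau> * lam t" using calculation tau_pos by simp
  ultimately show ?thesis unfolding h_def g_def by auto
qed

lemma abs_g_le: "\<bar>g t t' j z\<bar> \<le> \<tau> * lam t"
  using tau_pos lam_nonneg[of t] by (simp add: g_def)

text \<open>The alternative \<open>c = 0\<close> serves the levels with zero threshold, where the
  support may be larger than \<open>t\<close>.\<close>

lemma abs_sum_support_le:
  assumes "\<And>j. j \<in> {1..d} \<Longrightarrow> \<theta> j = 0 \<Longrightarrow> f j = 0"
    and "\<And>j. j \<in> {1..d} \<Longrightarrow> \<bar>f j :: real\<bar> \<le> c" "c \<ge> 0"
    and "card {j \<in> {1..d}. \<theta> j \<noteq> 0} \<le> t \<or> c = 0"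
  shows "\<bar>\<Sum>j=1..d. f j\<bar> \<le> real t * c"
proof -
  have "(\<Sum>j=1..d. f j) = (\<Sum>j\<in>{j \<in> {1..d}. \<theta> j \<noteq> 0}. f j)"
    using assms(1) by (intro sum.mono_neutral_right) auto
  also have "\<bar>\<dots>\<bar> \<le> (\<Sum>j\<in>{j \<in> {1..d}. \<theta> j \<noteq> 0}. \<bar>f j\<bar>)" by (rule sum_abs)
  also have "\<dots> \<le> real (card {j \<in> {1..d}. \<theta> j \<noteq> 0}) * c"
    using assms(2) by (intro sum_bounded_above) auto
  also have "\<dots> \<le> real t * c" using assms(3,4) by (auto intro: mult_right_mono)
  finally show ?thesis .
qed

section \<open>Deviation between two levels and risk at one level\<close>

abbreviation Phi :: "nat \<Rightarrow> real" where
  "Phi t \<equiv> Phi_adp \<alpha> d \<eta> (real t)"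

text \<open>The squared difference of two estimators on the event that their comparison in
  \<open>s_hat\<close> fails, and 0 elsewhere.\<close>

definition V :: "real \<Rightarrow> nat \<Rightarrow> nat \<Rightarrow> (nat \<Rightarrow> real) \<Rightarrow> real" where
  "V \<zeta> t t' y = (L_hat \<alpha> \<tau> d \<eta> 1 t y - L_hat \<alpha> \<tau> d \<eta> 1 t' y)\<^sup>2
     * (if \<bar>L_hat \<alpha> \<tau> d \<eta> 1 t y - L_hat \<alpha> \<tau> d \<eta> 1 t' y\<bar> > omega \<zeta> \<alpha> d \<eta> 1 t' then 1 else 0)"

lemma V_nonneg: "V \<zeta> t t' y \<ge> 0"
  by (simp add: V_def)

lemma V_measurable [measurable]: "(\<lambda>\<xi>. V \<zeta> t t' (\<lambda>j. \<theta> j + \<xi> j)) \<in> borel_measurable Q"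
  unfolding V_def by measurable

text \<open>The sixth power is the budget of the selection argument: 2 for the growth of the rate
  and 2 for each of the sums over \<open>t'\<close> and \<open>t\<close>.\<close>

lemma V_le:
  assumes tt': "1 \<le> t" "t < t'" "t' \<le> s0"
    and sparse: "card {j \<in> {1..d}. \<theta> j \<noteq> 0} \<le> t"
    and zeta: "\<zeta> > 0" "sqrt \<zeta> \<ge> 2 * \<tau> * max 2 (4 * half_level_const \<alpha>)" "sqrt \<zeta> \<ge> 4 * (mgf_const \<alpha> \<tau> + 6)"
  shows "(\<integral>\<^sup>+ \<xi>. ennreal (V \<zeta> t t' (\<lambda>j. \<theta> j + \<xi> j)) \<partial>Q) \<le> ennreal (64 * Phi t' / real t' ^ 6)"
proof -
  have ps: "Phi t' > 0" using Phi_adp_pos tt' by simp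
  define \<phi> where "\<phi> = sqrt (Phi t')"
  have \<phi>: "\<phi> > 0" "\<phi>\<^sup>2 = Phi t'" using ps by (simp_all add: \<phi>_def)
  define L where "L = ln (exp 1 * real t')"
  have L: "1 \<le> L" "L \<le> real t'" "ln (real t') \<le> L"
    using ln_exp1_ge_1[of t'] ln_exp1_le[of t'] tt' by (auto simp: L_def ln_mult)
  define om where "om = omega \<zeta> \<alpha> d \<eta> 1 t'"
  have om: "om = sqrt \<zeta> * \<phi>" by (simp add: om_def omega_def \<phi>_def real_sqrt_mult)
  \<comment> \<open>This choice makes the total log moment generating function at most
    \<open>mgf_const \<alpha> \<tau> * L\<close>, while \<open>u * om\<close> equals
    \<open>sqrt \<zeta> * L\<close>; both are multiples of \<open>L\<close>, and a large \<zeta>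
    wins.\<close>
  define u where "u = L / \<phi>"
  have u: "u > 0" using L \<phi> by (simp add: u_def)
  have PPle: "rate (real t') \<le> \<phi>\<^sup>2" using rate_le_Phi_adp tt' \<phi> by simp
  have uB: "u\<^sup>2 * B (b t') \<le> L"
  proof -
    have "0 \<le> (real t')\<^sup>2 * (lam (real t'))\<^sup>2" by simp
    then have "L * B (b t') \<le> \<phi>\<^sup>2" using PPle unfolding rate_def L_def by linarith
    then have "L * (L * B (b t')) \<le> L * \<phi>\<^sup>2" using L by (intro mult_left_mono) auto
    then show ?thesis using \<phi> ps by (simp add: u_def power_divide divide_le_eq power2_eq_square mult.assoc)
  qed
  have ulam: "u * lam t' \<le> 1"
  proof -
    have "(t' * lam t')\<^sup>2 \<le> rate (real t')"
      using L B_pos[of "b t'"] by (simp add: rate_def power_mult_distrib L_def[symmetric])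
    then have "(t' * lam t')\<^sup>2 \<le> \<phi>\<^sup>2" using PPle by simp
    then have "t' * lam t' \<le> \<phi>" using \<phi>(1) by (rule power2_le_imp_le[OF _ less_imp_le])
    moreover have "L * lam t' \<le> t' * lam t'" using L lam_nonneg by (intro mult_right_mono) auto
    ultimately show ?thesis using \<phi>(1) by (simp add: u_def)
  qed
  have ulam1: "u * lam t \<le> 1" if "\<alpha> < 2"
  proof -
    have "(L * lam 1)\<^sup>2 \<le> \<phi>\<^sup>2" using Phi_adp_le_2[of t'] tt' that \<phi> by (simp add: L_def mult.commute)
    then have "L * lam 1 \<le> \<phi>" using \<phi>(1) by (rule power2_le_imp_le[OF _ less_imp_le])
    moreover have "L * lam t \<le> L * lam 1" using L tt' lam_antimono[of 1 t] by (intro mult_left_mono) auto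
    ultimately show ?thesis using \<phi>(1) by (simp add: u_def)
  qed
  \<comment> \<open>Off the support the observation is pure noise, so these summands are odd
    functions of it.\<close>
  define \<psi> where "\<psi> = (\<lambda>j x. if \<theta> j = 0 then g t t' j (\<eta> j * x) else 0)"
  define X where "X = (\<lambda>\<xi>. \<Sum>j=1..d. \<psi> j (\<xi> j))"
  define w where "w = (\<lambda>j. mgf_const \<alpha> \<tau> * (u\<^sup>2 * (\<bar>\<eta> j\<bar>\<^sup>2 * exp (- ((lam t' / \<bar>\<eta> j\<bar>) powr \<alpha>)))))"
  have \<psi>m[measurable]: "\<psi> j \<in> borel_measurable borel" for j
    unfolding \<psi>_def by measurable
  have odd: "\<psi> j (- x) = - \<psi> j x" for j x by (auto simp: \<psi>_def g_def)
  have X_m[measurable]: "X \<in> borel_measurable Q" unfolding X_def by measurable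
  have mgf1: "(\<integral>\<^sup>+ x. ennreal (exp (u * \<psi> j x)) \<partial>P j) \<le> ennreal (exp (w j))" if j: "j \<in> {1..d}" for j
    unfolding w_def
  proof (rule noise_odd_mgf_le[OF noise[OF j] alpha_pos tau_pos \<psi>m odd])
    show "\<bar>\<psi> j x\<bar> \<le> \<bar>\<eta> j\<bar> * \<bar>x\<bar>" for x by (simp add: \<psi>_def g_def abs_mult)
    show "\<psi> j x = 0" if "1 < lam t' / \<bar>\<eta> j\<bar>" "\<bar>x\<bar> \<le> \<tau> * (lam t' / \<bar>\<eta> j\<bar>)" for x
    proof -
      have "\<bar>\<eta> j\<bar> < lam t'" "\<bar>\<eta> j * x\<bar> \<le> \<tau> * lam t'"
        using that eta_pos[OF j] by (auto simp: field_simps abs_mult)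
      then show ?thesis by (simp add: \<psi>_def g_def)
    qed
    \<comment> \<open>For \<alpha> below 2 the upper threshold bounds the summand via
      \<open>ulam1\<close>; otherwise the second alternative is just \<open>ulam\<close>.\<close>
    show "(\<forall>x. \<bar>u * \<psi> j x\<bar> \<le> \<tau>) \<or> 2 \<le> \<alpha> \<and> u * \<bar>\<eta> j\<bar> * (lam t' / \<bar>\<eta> j\<bar>) \<le> 1"
    proof (cases "\<alpha> < 2")
      case True
      have "\<bar>u * \<psi> j x\<bar> \<le> \<tau>" for x
      proof -
        have "\<bar>\<psi> j x\<bar> \<le> \<tau> * lam t"
          unfolding \<psi>_def using abs_g_le tau_pos lam_nonneg[of t] by auto
        then have "u * \<bar>\<psi> j x\<bar> \<le> u * (\<tau> * lam t)" using u by (intro mult_left_mono) auto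
        also have "\<dots> = \<tau> * (u * lam t)" by simp
        also have "\<dots> \<le> \<tau> * 1" using ulam1[OF True] tau_pos by (intro mult_left_mono) auto
        finally show ?thesis using u by (simp add: abs_mult)
      qed
      then show ?thesis by blast
    qed (use ulam eta_pos[OF j] in auto)
  qed (use eta_pos[OF j] lam_nonneg u in auto)
  have sumw: "(\<Sum>j=1..d. w j) \<le> mgf_const \<alpha> \<tau> * L"
  proof -
    have "(\<Sum>j=1..d. w j) = mgf_const \<alpha> \<tau> * (u\<^sup>2 * B (b t'))"
      by (simp add: w_def lam_powr B_def sum_distrib_left)
    then show ?thesis using uB mgf_const_ge(4) by (simp add: mult_left_mono)
  qed
  have mgf: "(\<integral>\<^sup>+ \<xi>. ennreal (exp (u * X \<xi>)) \<partial>Q) \<le> ennreal (exp (mgf_const \<alpha> \<tau> * L))"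
    unfolding X_def using sumw
    by (intro noise_sum_mgf_le[where w = w and \<alpha> = \<alpha> and \<tau> = \<tau>, THEN order_trans] noise mgf1 \<psi>m) (auto intro: ennreal_leI)
  have mgf': "(\<integral>\<^sup>+ \<xi>. ennreal (exp (- u * X \<xi>)) \<partial>Q) \<le> ennreal (exp (mgf_const \<alpha> \<tau> * L))"
    unfolding X_def
  proof (rule noise_sum_mgf_le[where w = w and \<alpha> = \<alpha> and \<tau> = \<tau>, THEN order_trans])
    fix j assume j: "j \<in> {1..d}"
    have "(\<integral>\<^sup>+ x. ennreal (exp (- u * \<psi> j x)) \<partial>P j) = (\<integral>\<^sup>+ x. ennreal (exp (u * \<psi> j x)) \<partial>P j)"
      by (simp only: noise_odd_mgf_eq[OF noise[OF j] \<psi>m odd]) (simp add: cosh_minus)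
    then show "(\<integral>\<^sup>+ x. ennreal (exp (- u * \<psi> j x)) \<partial>P j) \<le> ennreal (exp (w j))" using mgf1[OF j] by simp
  qed (use sumw noise in \<open>auto intro: ennreal_leI\<close>)
  define R where "R = (\<lambda>\<xi> :: nat \<Rightarrow> real. \<Sum>j=1..d. if \<theta> j = 0 then 0 else g t t' j (\<eta> j * (\<theta> j + \<xi> j)))"
  have D: "L_hat \<alpha> \<tau> d \<eta> 1 t (\<lambda>j. \<theta> j + \<xi> j) - L_hat \<alpha> \<tau> d \<eta> 1 t' (\<lambda>j. \<theta> j + \<xi> j) = - (X \<xi> + R \<xi>)" for \<xi>
  proof -
    have "L_hat \<alpha> \<tau> d \<eta> 1 t (\<lambda>j. \<theta> j + \<xi> j) - L_hat \<alpha> \<tau> d \<eta> 1 t' (\<lambda>j. \<theta> j + \<xi> j)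
        = (\<Sum>j=1..d. - g t t' j (\<eta> j * (\<theta> j + \<xi> j)))"
      unfolding L_hat_eq sum_subtractf[symmetric] using tt' by (intro sum.cong h_diff refl) auto
    also have "\<dots> = - (X \<xi> + R \<xi>)"
      unfolding X_def R_def sum.distrib[symmetric] sum_negf[symmetric]
      by (intro sum.cong) (auto simp: \<psi>_def)
    finally show ?thesis .
  qed
  \<comment> \<open>The first lower bound on \<open>sqrt \<zeta>\<close> is made for this: the
    support uses at most half of the tolerance.\<close>
  have R: "\<bar>R \<xi>\<bar> \<le> om / 2" for \<xi>
  proof -
    have "\<bar>R \<xi>\<bar> \<le> real t * (\<tau> * lam t)"
      unfolding R_def using abs_g_le tau_pos lam_nonneg[of t] sparse
      by (intro abs_sum_support_le[where \<theta> = \<theta>]) auto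
    also have "\<dots> = \<tau> * (real t * lam t)" by simp
    also have "\<dots> \<le> \<tau> * (max 2 (4 * half_level_const \<alpha>) * sqrt (rate (real t')))"
      using tt' tau_pos lam_pos[of t] by (intro mult_left_mono s_lam_le) auto
    also have "\<dots> \<le> \<tau> * (max 2 (4 * half_level_const \<alpha>) * \<phi>)"
      using PPle \<phi>(1) tau_pos real_sqrt_le_mono[OF PPle] by (intro mult_left_mono) auto
    also have "\<dots> = (2 * \<tau> * max 2 (4 * half_level_const \<alpha>)) * \<phi> / 2" by simp
    also have "\<dots> \<le> om / 2" unfolding om using zeta \<phi>(1) by (intro divide_right_mono mult_right_mono) auto
    finally show ?thesis .
  qed
  \<comment> \<open>A failed comparison forces \<open>\<bar>X \<xi>\<bar> > om / 2\<close>, and the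
    squared difference is at most \<open>4 * (X \<xi>)\<^sup>2\<close>; with the 8 of
    \<open>sq_indicator_le_cosh\<close> this makes 32.\<close>
  define c where "c = 32 / u\<^sup>2 * exp (- u * (om / 2) / 2)"
  have c: "c \<ge> 0" by (simp add: c_def)
  have "V \<zeta> t t' (\<lambda>j. \<theta> j + \<xi> j) \<le> c * (exp (u * X \<xi>) + exp (- u * X \<xi>))" for \<xi>
  proof (cases "\<bar>X \<xi> + R \<xi>\<bar> > om")
    case True
    have X: "\<bar>X \<xi>\<bar> > om / 2" "\<bar>X \<xi> + R \<xi>\<bar> \<le> 2 * \<bar>X \<xi>\<bar>"
      using True R[of \<xi>] abs_triangle_ineq[of "X \<xi>" "R \<xi>"] by linarith+
    have "(X \<xi> + R \<xi>)\<^sup>2 \<le> 4 * (X \<xi>)\<^sup>2"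
      using power_mono[OF X(2), of 2] by (simp add: power_mult_distrib)
    also have "\<dots> \<le> 4 * (8 / u\<^sup>2 * exp (- u * (om / 2) / 2) * (exp (u * X \<xi>) + exp (- u * X \<xi>)))"
      by (intro mult_left_mono sq_indicator_le_cosh u X) auto
    finally show ?thesis
      unfolding V_def D om_def[symmetric] using True by (simp add: c_def abs_minus_commute power2_commute algebra_simps)
  next
    case False
    then have "V \<zeta> t t' (\<lambda>j. \<theta> j + \<xi> j) = 0"
      unfolding V_def D om_def[symmetric] abs_minus_cancel by simp
    then show ?thesis using c by simp
  qed
  then have "(\<integral>\<^sup>+ \<xi>. ennreal (V \<zeta> t t' (\<lambda>j. \<theta> j + \<xi> j)) \<partial>Q)
      \<le> (\<integral>\<^sup>+ \<xi>. ennreal c * (ennreal (exp (u * X \<xi>)) + ennreal (exp (- u * X \<xi>))) \<partial>Q)"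
    using c by (intro nn_integral_mono) (simp add: ennreal_leI flip: ennreal_plus ennreal_mult)
  also have "\<dots> = ennreal c * ((\<integral>\<^sup>+ \<xi>. ennreal (exp (u * X \<xi>)) \<partial>Q) + (\<integral>\<^sup>+ \<xi>. ennreal (exp (- u * X \<xi>)) \<partial>Q))"
  proof -
    have m: "(\<lambda>\<xi>. ennreal (exp (u * X \<xi>))) \<in> borel_measurable Q" "(\<lambda>\<xi>. ennreal (exp (- u * X \<xi>))) \<in> borel_measurable Q"
      by measurable
    show ?thesis
      by (simp only: nn_integral_cmult[OF borel_measurable_add[OF m]] nn_integral_add[OF m])
  qed
  also have "\<dots> \<le> ennreal c * (ennreal (exp (mgf_const \<alpha> \<tau> * L)) + ennreal (exp (mgf_const \<alpha> \<tau> * L)))"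
    by (intro mult_left_mono add_mono mgf mgf') auto
  also have "\<dots> = ennreal (2 * c * exp (mgf_const \<alpha> \<tau> * L))"
    using c by (simp flip: ennreal_plus ennreal_mult)
  also have "2 * c * exp (mgf_const \<alpha> \<tau> * L) \<le> 64 * Phi t' / real t' ^ 6"
  proof -
    have uom: "u * om = sqrt \<zeta> * L" using \<phi> by (simp add: u_def om)
    have "2 * c * exp (mgf_const \<alpha> \<tau> * L) = 64 * (1 / u\<^sup>2) * exp (mgf_const \<alpha> \<tau> * L - sqrt \<zeta> / 4 * L)"
    proof -
      have "- u * (om / 2) / 2 = - (sqrt \<zeta> / 4 * L)" using uom by simp
      then have "2 * c * exp (mgf_const \<alpha> \<tau> * L) = 64 * (1 / u\<^sup>2) * (exp (- (sqrt \<zeta> / 4 * L)) * exp (mgf_const \<alpha> \<tau> * L))"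
        by (simp add: c_def)
      also have "exp (- (sqrt \<zeta> / 4 * L)) * exp (mgf_const \<alpha> \<tau> * L) = exp (mgf_const \<alpha> \<tau> * L - sqrt \<zeta> / 4 * L)"
        unfolding exp_add[symmetric] by simp
      finally show ?thesis .
    qed
    also have "\<dots> \<le> 64 * \<phi>\<^sup>2 * (1 / real t' ^ 6)"
    proof (rule mult_mono)
      have "1 * \<phi>\<^sup>2 \<le> L\<^sup>2 * \<phi>\<^sup>2" using L by (intro mult_right_mono) (auto simp: one_le_power)
      then show "64 * (1 / u\<^sup>2) \<le> 64 * \<phi>\<^sup>2" using L by (simp add: u_def power_divide field_simps)
      \<comment> \<open>The second lower bound on \<open>sqrt \<zeta>\<close> leaves an exponent of
        at most \<open>- 6 * L\<close>.\<close>
      have "(mgf_const \<alpha> \<tau> + 6) * L \<le> sqrt \<zeta> / 4 * L" using zeta(3) L by (intro mult_right_mono) auto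
      then have "mgf_const \<alpha> \<tau> * L - sqrt \<zeta> / 4 * L \<le> - (6 * ln (real t'))" using L(3) by (simp add: algebra_simps)
      then have "exp (mgf_const \<alpha> \<tau> * L - sqrt \<zeta> / 4 * L) \<le> exp (- (6 * ln (real t')))" by simp
      also have "\<dots> = 1 / real t' ^ 6" 
        using tt' exp_of_nat_mult[of 6 "ln (real t')"] by (simp add: exp_minus inverse_eq_divide)
      finally show "exp (mgf_const \<alpha> \<tau> * L - sqrt \<zeta> / 4 * L) \<le> 1 / real t' ^ 6" .
    qed auto
    finally show ?thesis by (simp add: \<phi>)
  qed
  then have "ennreal (2 * c * exp (mgf_const \<alpha> \<tau> * L)) \<le> ennreal (64 * Phi t' / real t' ^ 6)" by (rule ennreal_leI)
  finally show ?thesis .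
qed

text \<open>The error splits into a centred noise part \<open>S\<close>, thresholded only off the
  support, and the bias \<open>R\<close> of thresholding on the support, at most
  \<open>\<tau> * lam t\<close> per coordinate. If \<open>lam t = 0\<close>, the bias vanishes
  whatever the support.\<close>

lemma risk_le:
  assumes t: "1 \<le> t" and sparse: "card {j \<in> {1..d}. \<theta> j \<noteq> 0} \<le> t \<or> lam (real t) = 0"
  shows "(\<integral>\<^sup>+ \<xi>. ennreal ((L_hat \<alpha> \<tau> d \<eta> 1 t (\<lambda>j. \<theta> j + \<xi> j) - lin_func d \<eta> \<theta>)\<^sup>2) \<partial>Q)
     \<le> ennreal (2 * (exp 1 * sq_const \<alpha> \<tau> + \<tau>\<^sup>2) * rate (real t))"
proof -
  define l where "l = lam (real t)"
  have l: "l \<ge> 0" by (simp add: l_def lam_nonneg)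
  define f where "f = (\<lambda>j x. if \<theta> j = 0 then h t j (\<eta> j * x) else \<eta> j * x)"
  define S where "S = (\<lambda>\<xi>. \<Sum>j=1..d. f j (\<xi> j))"
  define v where "v = (\<lambda>j. exp 1 * sq_const \<alpha> \<tau> * ((\<eta> j)\<^sup>2 * exp (- ((l / \<bar>\<eta> j\<bar>) powr \<alpha>)))
     + (if \<theta> j = 0 then 0 else sq_const \<alpha> \<tau> * l\<^sup>2))"
  have fm[measurable]: "f j \<in> borel_measurable borel" for j
    unfolding f_def by measurable
  have odd: "f j (- x) = - f j x" for j x by (simp add: f_def h_def)
  have Sm[measurable]: "S \<in> borel_measurable Q" unfolding S_def by measurable
  have fl: "\<bar>f j x\<bar> \<le> \<bar>\<eta> j\<bar> * \<bar>x\<bar>" for j x by (simp add: f_def h_def abs_mult)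
  have sq: "(\<integral>\<^sup>+ x. ennreal ((f j x)\<^sup>2) \<partial>P j) \<le> ennreal (v j)" if j: "j \<in> {1..d}" for j
  proof (cases "\<theta> j = 0")
    case True
    have "(\<integral>\<^sup>+ x. ennreal ((f j x)\<^sup>2) \<partial>P j) \<le> ennreal (sq_const \<alpha> \<tau> * (\<bar>\<eta> j\<bar>\<^sup>2 * exp (- ((l / \<bar>\<eta> j\<bar>) powr \<alpha>))))"
    proof (rule noise_sq_le[OF noise[OF j] alpha_pos tau_pos fl])
      show "f j x = 0" if "1 < l / \<bar>\<eta> j\<bar>" "\<bar>x\<bar> \<le> \<tau> * (l / \<bar>\<eta> j\<bar>)" for x
      proof -
        have "\<bar>\<eta> j\<bar> < l" "\<bar>\<eta> j * x\<bar> \<le> \<tau> * l"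
          using that eta_pos[OF j] by (auto simp: field_simps abs_mult)
        then show ?thesis by (simp add: f_def h_def True l_def)
      qed
    qed (use eta_pos[OF j] l in auto)
    also have "\<dots> \<le> ennreal (v j)"
    proof (intro ennreal_leI)
      have "1 * sq_const \<alpha> \<tau> \<le> exp 1 * sq_const \<alpha> \<tau>" using sq_const_nonneg by (intro mult_right_mono) auto
      then show "sq_const \<alpha> \<tau> * (\<bar>\<eta> j\<bar>\<^sup>2 * exp (- ((l / \<bar>\<eta> j\<bar>) powr \<alpha>))) \<le> v j"
        unfolding v_def using True by (simp add: mult_right_mono)
    qed
    finally show ?thesis .
  next
    case False
    \<comment> \<open>On the support nothing is thresholded, so \<open>r = 0\<close>; as
      \<open>0 powr \<alpha>\<close> is 0, the bound is a multiple of
      \<open>(\<eta> j)\<^sup>2\<close>.\<close>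
    have "(\<integral>\<^sup>+ x. ennreal ((f j x)\<^sup>2) \<partial>P j) \<le> ennreal (sq_const \<alpha> \<tau> * (\<bar>\<eta> j\<bar>\<^sup>2 * exp (- (0 powr \<alpha>))))"
      using eta_pos[OF j] by (intro noise_sq_le[OF noise[OF j] alpha_pos tau_pos fl]) auto
    also have "\<dots> \<le> ennreal (v j)"
    proof (intro ennreal_leI)
      \<comment> \<open>A coefficient above the threshold is covered by its summand in
        \<open>B\<close>, one below it by \<open>l\<^sup>2\<close>.\<close>
      have "(\<eta> j)\<^sup>2 \<le> exp 1 * ((\<eta> j)\<^sup>2 * exp (- ((l / \<bar>\<eta> j\<bar>) powr \<alpha>))) + l\<^sup>2"
      proof (cases "l \<le> \<bar>\<eta> j\<bar>")
        case True
        then have "(l / \<bar>\<eta> j\<bar>) powr \<alpha> \<le> 1"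
          using eta_pos[OF j] l alpha_pos by (intro powr_le1) auto
        then have "1 \<le> exp (1 - (l / \<bar>\<eta> j\<bar>) powr \<alpha>)" by simp
        then have "(\<eta> j)\<^sup>2 * 1 \<le> (\<eta> j)\<^sup>2 * exp (1 - (l / \<bar>\<eta> j\<bar>) powr \<alpha>)" by (intro mult_left_mono) auto
        also have "\<dots> = exp 1 * ((\<eta> j)\<^sup>2 * exp (- ((l / \<bar>\<eta> j\<bar>) powr \<alpha>)))"
          by (simp add: exp_diff exp_minus divide_inverse)
        finally show ?thesis by (simp add: add_increasing2)
      next
        case False
        then have "\<bar>\<eta> j\<bar>\<^sup>2 \<le> l\<^sup>2" by (intro power_mono) auto
        then show ?thesis by (simp add: add_increasing)
      qed
      then have "sq_const \<alpha> \<tau> * (\<eta> j)\<^sup>2 \<le> sq_const \<alpha> \<tau> * (exp 1 * ((\<eta> j)\<^sup>2 * exp (- ((l / \<bar>\<eta> j\<bar>) powr \<alpha>))) + l\<^sup>2)"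
        using sq_const_nonneg by (intro mult_left_mono) auto
      then show "sq_const \<alpha> \<tau> * (\<bar>\<eta> j\<bar>\<^sup>2 * exp (- (0 powr \<alpha>))) \<le> v j"
        using False by (simp add: v_def algebra_simps)
    qed
    finally show ?thesis .
  qed
  have v0: "v j \<ge> 0" for j using sq_const_nonneg by (simp add: v_def)
  have S2: "(\<integral>\<^sup>+ \<xi>. ennreal ((S \<xi>)\<^sup>2) \<partial>Q) \<le> ennreal (\<Sum>j=1..d. v j)"
    unfolding S_def by (intro noise_sum_sq_le[where \<alpha> = \<alpha> and \<tau> = \<tau>] noise sq v0 odd fm) auto
  have tl: "(\<Sum>j=1..d. if \<theta> j = 0 then 0 else l\<^sup>2) \<le> (real t)\<^sup>2 * l\<^sup>2"
  proof -
    have "\<bar>\<Sum>j=1..d. if \<theta> j = 0 then 0 else l\<^sup>2\<bar> \<le> real t * l\<^sup>2"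
      using sparse by (intro abs_sum_support_le[where \<theta> = \<theta>]) (auto simp: l_def)
    also have "\<dots> \<le> (real t)\<^sup>2 * l\<^sup>2" using t by (intro mult_right_mono) (auto simp: self_le_power)
    finally show ?thesis by simp
  qed
  have sv: "(\<Sum>j=1..d. v j) \<le> exp 1 * sq_const \<alpha> \<tau> * rate (real t)"
  proof -
    have "(\<Sum>j=1..d. v j) = exp 1 * sq_const \<alpha> \<tau> * B (b t) + sq_const \<alpha> \<tau> * (\<Sum>j=1..d. if \<theta> j = 0 then 0 else l\<^sup>2)"
      unfolding v_def sum.distrib B_def sum_distrib_left l_def lam_powr
      by (intro arg_cong2[of _ _ _ _ "(+)"] sum.cong) auto
    also have "\<dots> \<le> exp 1 * sq_const \<alpha> \<tau> * (ln (exp 1 * real t) * B (b t)) + exp 1 * sq_const \<alpha> \<tau> * ((real t)\<^sup>2 * l\<^sup>2)"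
    proof (intro add_mono mult_left_mono mult_mono tl)
      show "B (b t) \<le> ln (exp 1 * real t) * B (b t)"
        using mult_right_mono[OF ln_exp1_ge_1[of t], of "B (b t)"] B_pos[of "b t"] t by simp
      show "sq_const \<alpha> \<tau> \<le> exp 1 * sq_const \<alpha> \<tau>" using mult_right_mono[of 1 "exp 1" "sq_const \<alpha> \<tau>"] sq_const_nonneg by simp
    qed (use sq_const_nonneg in \<open>auto intro!: sum_nonneg\<close>)
    also have "\<dots> = exp 1 * sq_const \<alpha> \<tau> * rate (real t)" by (simp add: rate_def l_def algebra_simps)
    finally show ?thesis .
  qed
  define R where "R = (\<lambda>\<xi> :: nat \<Rightarrow> real. \<Sum>j=1..d. if \<theta> j = 0 then 0
      else h t j (\<eta> j * (\<theta> j + \<xi> j)) - \<eta> j * (\<theta> j + \<xi> j))"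
  have D: "L_hat \<alpha> \<tau> d \<eta> 1 t (\<lambda>j. \<theta> j + \<xi> j) - lin_func d \<eta> \<theta> = S \<xi> + R \<xi>" for \<xi>
    unfolding L_hat_eq lin_func_def S_def R_def sum_subtractf[symmetric] sum.distrib[symmetric]
    by (intro sum.cong) (auto simp: f_def algebra_simps)
  have R: "\<bar>R \<xi>\<bar> \<le> real t * (\<tau> * l)" for \<xi>
    unfolding R_def using tau_pos l sparse
    by (intro abs_sum_support_le[where \<theta> = \<theta>]) (auto simp: h_def l_def)
  define c where "c = 2 * (real t * (\<tau> * l))\<^sup>2"
  have "(\<integral>\<^sup>+ \<xi>. ennreal ((S \<xi> + R \<xi>)\<^sup>2) \<partial>Q) \<le> (\<integral>\<^sup>+ \<xi>. 2 * ennreal ((S \<xi>)\<^sup>2) + ennreal c \<partial>Q)"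
  proof (intro nn_integral_mono)
    fix \<xi>
    have "(R \<xi>)\<^sup>2 \<le> (real t * (\<tau> * l))\<^sup>2" using power_mono[OF R[of \<xi>], of 2] by simp
    then have "(S \<xi> + R \<xi>)\<^sup>2 \<le> 2 * (S \<xi>)\<^sup>2 + c"
      using sum_squares_ge_zero[of "S \<xi> - R \<xi>" 0] by (simp add: c_def power2_eq_square algebra_simps)
    then have "ennreal ((S \<xi> + R \<xi>)\<^sup>2) \<le> ennreal (2 * (S \<xi>)\<^sup>2 + c)" by (rule ennreal_leI)
    also have "\<dots> = 2 * ennreal ((S \<xi>)\<^sup>2) + ennreal c" by (simp add: c_def ennreal_mult)
    finally show "ennreal ((S \<xi> + R \<xi>)\<^sup>2) \<le> 2 * ennreal ((S \<xi>)\<^sup>2) + ennreal c" .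
  qed
  also have "\<dots> = 2 * (\<integral>\<^sup>+ \<xi>. ennreal ((S \<xi>)\<^sup>2) \<partial>Q) + ennreal c"
    by (subst nn_integral_add, measurable, subst nn_integral_cmult, measurable)
      (simp add: Q.emeasure_space_1 del: One_nat_def)
  also have "\<dots> \<le> 2 * ennreal (\<Sum>j=1..d. v j) + ennreal c"
    by (intro add_mono mult_left_mono S2) auto
  also have "\<dots> = ennreal (2 * (\<Sum>j=1..d. v j) + c)"
    using v0 by (simp add: c_def ennreal_mult sum_nonneg)
  also have "2 * (\<Sum>j=1..d. v j) + c \<le> 2 * (exp 1 * sq_const \<alpha> \<tau> + \<tau>\<^sup>2) * rate (real t)"
  proof -
    have "(real t)\<^sup>2 * l\<^sup>2 \<le> rate (real t)"
      using ln_exp1_ge_1[of t] B_pos[of "b t"] t unfolding rate_def l_def by (simp del: ln_ge_zero_iff)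
    then have "c \<le> 2 * \<tau>\<^sup>2 * rate (real t)"
      using mult_left_mono[of "(real t)\<^sup>2 * l\<^sup>2" "rate (real t)" "2 * \<tau>\<^sup>2"] by (simp add: c_def power_mult_distrib mult_ac)
    then show ?thesis using sv by (simp add: algebra_simps)
  qed
  then have "ennreal (2 * (\<Sum>j=1..d. v j) + c) \<le> ennreal (2 * (exp 1 * sq_const \<alpha> \<tau> + \<tau>\<^sup>2) * rate (real t))"
    by (rule ennreal_leI)
  finally show ?thesis unfolding D .
qed

end

section \<open>Adaptive selection\<close>

text \<open>Telescoping gives the stronger bound \<open>2 - 1 / n\<close>, which carries the
  induction.\<close>

lemma sum_inverse_squares_le: "(\<Sum>t=1..n. 1 / (real t)\<^sup>2) \<le> 2"
proof -
  have "(\<Sum>t=1..n. 1 / (real t)\<^sup>2) \<le> 2 - 1 / real n" if "n \<ge> 1"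
    using that
  proof (induction n rule: dec_induct)
    case (step n)
    have "1 / (real (Suc n))\<^sup>2 \<le> 1 / (real n * real (Suc n))"
      using step.hyps unfolding power2_eq_square by (intro divide_left_mono mult_right_mono) auto
    also have "\<dots> = 1 / real n - 1 / real (Suc n)"
      using step.hyps by (simp add: field_simps)
    finally have "1 / (real (Suc n))\<^sup>2 \<le> 1 / real n - 1 / real (Suc n)" .
    then show ?case using step by simp
  qed simp
  then show ?thesis by (cases "n \<ge> 1") (auto intro: order_trans)
qed

lemma sum_inverse_squares_subset_le:
  assumes "T \<subseteq> {1..n}"
  shows "(\<Sum>t\<in>T. 1 / (real t)\<^sup>2) \<le> 2"
  using sum_mono2[OF _ assms, of "\<lambda>t. 1 / (real t)\<^sup>2"] sum_inverse_squares_le[of n] by fastforce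

context loss_noise
begin

text \<open>From \<open>s0\<close> up to \<open>d\<close> all thresholds are 0, so each of these
  estimators is the plain linear one.\<close>

lemma L_hat_s0:
  assumes "s0 \<le> t" "t \<le> d"
  shows "L_hat \<alpha> \<tau> d \<eta> 1 t y = L_hat \<alpha> \<tau> d \<eta> 1 s0 y"
  unfolding L_hat_eq h_def using lam_zero[OF assms] lam_zero[of s0] assms by simp

lemma omega_s0: "s0 \<le> t \<Longrightarrow> omega \<zeta> \<alpha> d \<eta> 1 t = omega \<zeta> \<alpha> d \<eta> 1 s0"
  using Phi_adp_const[of t] by (simp add: omega_def)

lemma omega_sq: "\<zeta> > 0 \<Longrightarrow> 1 \<le> t \<Longrightarrow> t \<le> s0 \<Longrightarrow> (omega \<zeta> \<alpha> d \<eta> 1 t)\<^sup>2 = \<zeta> * Phi t"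
  using Phi_adp_pos[of t] by (simp add: omega_def)

text \<open>A deterministic bound. If the selected level is at most \<open>r\<close>, its comparison
  with \<open>r\<close> succeeded or is trivial. If it exceeds \<open>r\<close>, its predecessor was
  rejected; the failed comparison with some \<open>q\<close> makes \<open>V\<close> there at least
  \<open>\<zeta> * Phi q\<close>, and this pays for \<open>\<zeta> * Phi sh\<close> after rescaling
  by \<open>Phi sh / Phi q\<close>.\<close>

lemma selected_error_le:
  fixes y :: "nat \<Rightarrow> real" and \<zeta> :: real
  defines "Lh \<equiv> \<lambda>t. L_hat \<alpha> \<tau> d \<eta> 1 t y" and "sh \<equiv> s_hat \<zeta> \<alpha> \<tau> d \<eta> 1 y"
  assumes zeta: "\<zeta> > 0" and r: "1 \<le> r" "r \<le> s0" "r \<le> d"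
  shows "(Lh sh - Lh r)\<^sup>2 \<le> \<zeta> * Phi r
    + (\<Sum>t\<in>{r<..min s0 d}. V \<zeta> r t y + (\<Sum>t'\<in>{t..min s0 d}. Phi t / Phi t' * V \<zeta> (t - 1) t' y))"
    (is "_ \<le> _ + sum ?f _")
proof -
  define om where "om = (\<lambda>t. omega \<zeta> \<alpha> d \<eta> 1 t)"
  define S where "S = {s \<in> {1..s_star \<alpha> d \<eta>}. \<forall>s'\<in>{s<..d}. \<bar>Lh s - Lh s'\<bar> \<le> om s'}"
  have sh: "sh = (if S = {} then s0 else Min S)"
    unfolding sh_def s_hat_def Let_def S_def Lh_def om_def ..
  have fin: "finite S" by (simp add: S_def)
  have s0: "s0 = s_star \<alpha> d \<eta> + 1" by (simp add: s_zero_def)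
  have sh_S: "sh \<in> S \<or> sh = s0" using Min_in[OF fin] by (auto simp: sh)
  have sh_le: "sh \<le> s0" using sh_S by (auto simp: S_def s0)
  have sh_le_d: "sh \<le> d"
  proof (cases "sh \<in> S")
    case True
    then show ?thesis using s_star_le by (auto simp: S_def)
  next
    case False
    then have "S = {}" using Min_in[OF fin] by (auto simp: sh split: if_splits)
    \<comment> \<open>For \<open>s_star\<close> equal to \<open>d\<close>, the level
      \<open>d\<close> has no later competitor and would belong to \<open>S\<close>.\<close>
    then have "s_star \<alpha> d \<eta> \<noteq> d" using d_ge_1 by (force simp: S_def)
    then show ?thesis using sh_le s_star_le s0 by simp
  qed
  have f0: "?f t \<ge> 0" if "t \<in> {r<..min s0 d}" for t
  proof -
    have "Phi t / Phi t' * V \<zeta> (t - 1) t' y \<ge> 0" if "t' \<in> {t..min s0 d}" for t'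
      using Phi_adp_pos[of t] Phi_adp_pos[of t'] \<open>t \<in> {r<..min s0 d}\<close> that r
      by (intro mult_nonneg_nonneg divide_nonneg_nonneg V_nonneg) auto
    then show ?thesis by (intro add_nonneg_nonneg sum_nonneg V_nonneg)
  qed
  then have sum0: "sum ?f {r<..min s0 d} \<ge> 0" by (rule sum_nonneg)
  have P0: "\<zeta> * Phi r \<ge> 0" using Phi_adp_pos[of r] r zeta by simp
  show ?thesis
  proof (cases "sh \<le> r")
    case True
    have "\<bar>Lh sh - Lh r\<bar> \<le> om r"
    proof (cases "sh = r")
      case True
      then show ?thesis using P0 by (simp add: om_def omega_def)
    next
      case False
      then have "sh \<in> S" "r \<in> {sh<..d}" using True sh_S r by auto
      then show ?thesis by (auto simp: S_def)
    qed
    then have "(Lh sh - Lh r)\<^sup>2 \<le> (om r)\<^sup>2" by (metis abs_ge_zero power2_abs power_mono)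
    also have "\<dots> = \<zeta> * Phi r" unfolding om_def by (rule omega_sq[OF zeta r(1,2)])
    finally show ?thesis using sum0 by simp
  next
    case False
    then have t: "r < sh" by simp
    have "sh - 1 \<in> {1..s_star \<alpha> d \<eta>}" using t r sh_le s0 by auto
    moreover have "sh - 1 \<notin> S"
    proof
      assume "sh - 1 \<in> S"
      then have "sh \<le> sh - 1" using Min_le[OF fin] by (auto simp: sh split: if_splits)
      then show False using t by simp
    qed
    ultimately obtain s' where s': "s' \<in> {sh - 1<..d}" "\<bar>Lh (sh - 1) - Lh s'\<bar> > om s'"
      by (auto simp: S_def not_le)
    \<comment> \<open>Estimators and tolerances are constant from \<open>s0\<close> on, so the
      failing competitor may be moved down to \<open>s0\<close>, which keeps it at or above
      \<open>sh\<close>.\<close>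
    define q where "q = min s' s0"
    have "Lh s' = Lh q" "om s' = om q"
      using s' L_hat_s0[of s' y] omega_s0[of s' \<zeta>] by (auto simp: q_def min_def Lh_def om_def)
    then have q: "\<bar>Lh (sh - 1) - Lh q\<bar> > om q" "q \<in> {sh..min s0 d}" "1 \<le> q" "q \<le> s0"
      using s' t sh_le by (auto simp: q_def)
    have Pq: "Phi q > 0" using Phi_adp_pos q by simp
    have Ps: "Phi sh > 0" using Phi_adp_pos[of sh] t r sh_le by simp
    have "om q \<ge> 0" using Pq zeta by (simp add: om_def omega_def)
    then have "(om q)\<^sup>2 \<le> \<bar>Lh (sh - 1) - Lh q\<bar>\<^sup>2" using q by (intro power_mono) auto
    then have "\<zeta> * Phi q \<le> V \<zeta> (sh - 1) q y"
      using q omega_sq[OF zeta, of q] by (simp add: V_def Lh_def om_def)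
    then have "Phi sh / Phi q * (\<zeta> * Phi q) \<le> Phi sh / Phi q * V \<zeta> (sh - 1) q y"
      using Pq Ps by (intro mult_left_mono) auto
    then have "\<zeta> * Phi sh \<le> Phi sh / Phi q * V \<zeta> (sh - 1) q y" using Pq by (simp add: mult.commute)
    also have "\<dots> \<le> (\<Sum>t'\<in>{sh..min s0 d}. Phi sh / Phi t' * V \<zeta> (sh - 1) t' y)"
    proof (rule member_le_sum[OF q(2)])
      fix t' assume "t' \<in> {sh..min s0 d} - {q}"
      then have "Phi t' > 0" using Phi_adp_pos[of t'] t r by auto
      then show "0 \<le> Phi sh / Phi t' * V \<zeta> (sh - 1) t' y"
        using Ps by (intro mult_nonneg_nonneg divide_nonneg_nonneg V_nonneg) auto
    qed simp
    finally have 1: "\<zeta> * Phi sh \<le> (\<Sum>t'\<in>{sh..min s0 d}. Phi sh / Phi t' * V \<zeta> (sh - 1) t' y)" .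
    \<comment> \<open>Either the comparison of \<open>r\<close> with \<open>sh\<close> fails and
      \<open>V\<close> is the squared difference, or that difference is within the tolerance at
      \<open>sh\<close>.\<close>
    have "(Lh sh - Lh r)\<^sup>2 \<le> V \<zeta> r sh y + \<zeta> * Phi sh"
    proof (cases "\<bar>Lh r - Lh sh\<bar> > om sh")
      case True
      then show ?thesis using Ps zeta by (simp add: V_def Lh_def om_def power2_commute)
    next
      case False
      then have "\<bar>Lh r - Lh sh\<bar>\<^sup>2 \<le> (om sh)\<^sup>2" by (intro power_mono) auto
      also have "\<dots> = \<zeta> * Phi sh" unfolding om_def using t r sh_le zeta by (intro omega_sq) auto
      finally show ?thesis using V_nonneg[of \<zeta> r sh y] by (simp add: power2_commute)
    qed
    also have "\<dots> \<le> ?f sh" using 1 by simp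
    also have "\<dots> \<le> sum ?f {r<..min s0 d}"
      using t sh_le sh_le_d f0 by (intro member_le_sum) auto
    finally show ?thesis using P0 by simp
  qed
qed

text \<open>In the inner sum the weights cancel \<open>Phi t'\<close>, leaving a multiple of
  \<open>Phi t / t ^ 4\<close>; \<open>Phi_adp_growth\<close> then reduces this to a summable
  multiple of \<open>Phi r / t\<^sup>2\<close>.\<close>

lemma sum_V_le:
  assumes r: "1 \<le> r" "r \<le> s0"
    and sparse: "r < min s0 d \<Longrightarrow> card {j \<in> {1..d}. \<theta> j \<noteq> 0} \<le> r"
    and zeta: "\<zeta> > 0" "sqrt \<zeta> \<ge> 2 * \<tau> * max 2 (4 * half_level_const \<alpha>)" "sqrt \<zeta> \<ge> 4 * (mgf_const \<alpha> \<tau> + 6)"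
  shows "(\<integral>\<^sup>+ \<xi>. ennreal (\<Sum>t\<in>{r<..min s0 d}. V \<zeta> r t (\<lambda>j. \<theta> j + \<xi> j)
      + (\<Sum>t'\<in>{t..min s0 d}. Phi t / Phi t' * V \<zeta> (t - 1) t' (\<lambda>j. \<theta> j + \<xi> j))) \<partial>Q)
    \<le> ennreal (384 * Phi r)"
proof -
  define m where "m = min s0 d"
  define v where "v = (\<lambda>t t' \<xi>. V \<zeta> t t' (\<lambda>j. \<theta> j + \<xi> j))"
  have v_m[measurable]: "v t t' \<in> borel_measurable Q" for t t'
    unfolding v_def by measurable
  have v0: "v t t' \<xi> \<ge> 0" for t t' \<xi> by (simp add: v_def V_nonneg)
  have v_le: "(\<integral>\<^sup>+ \<xi>. ennreal (v t t' \<xi>) \<partial>Q) \<le> ennreal (64 * Phi t' / real t' ^ 6)"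
    if "r \<le> t" "t < t'" "t' \<le> m" for t t'
    unfolding v_def using that r sparse zeta by (intro V_le) (auto simp: m_def)
  have Pp: "Phi t > 0" if "r \<le> t" "t \<le> m" for t
    using that r by (intro Phi_adp_pos) (auto simp: m_def)
  define I where "I = (\<lambda>t. 64 * Phi t / real t ^ 6 + (\<Sum>t'\<in>{t..m}. Phi t / Phi t' * (64 * Phi t' / real t' ^ 6)))"
  have "(\<integral>\<^sup>+ \<xi>. ennreal (\<Sum>t\<in>{r<..m}. v r t \<xi> + (\<Sum>t'\<in>{t..m}. Phi t / Phi t' * v (t - 1) t' \<xi>)) \<partial>Q)
      = (\<integral>\<^sup>+ \<xi>. (\<Sum>t\<in>{r<..m}. ennreal (v r t \<xi>) + (\<Sum>t'\<in>{t..m}. ennreal (Phi t / Phi t') * ennreal (v (t - 1) t' \<xi>))) \<partial>Q)"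
  proof (intro nn_integral_cong)
    fix \<xi>
    have c0: "Phi t / Phi t' \<ge> 0" if "t \<in> {r<..m}" "t' \<in> {t..m}" for t t'
      using Pp[of t] Pp[of t'] that by auto
    have "ennreal (\<Sum>t\<in>{r<..m}. v r t \<xi> + (\<Sum>t'\<in>{t..m}. Phi t / Phi t' * v (t - 1) t' \<xi>))
        = (\<Sum>t\<in>{r<..m}. ennreal (v r t \<xi> + (\<Sum>t'\<in>{t..m}. Phi t / Phi t' * v (t - 1) t' \<xi>)))"
      using c0 v0 by (intro sum_ennreal[symmetric] add_nonneg_nonneg sum_nonneg mult_nonneg_nonneg) auto
    also have "\<dots> = (\<Sum>t\<in>{r<..m}. ennreal (v r t \<xi>) + (\<Sum>t'\<in>{t..m}. ennreal (Phi t / Phi t') * ennreal (v (t - 1) t' \<xi>)))"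
    proof (intro sum.cong refl)
      fix t assume t: "t \<in> {r<..m}"
      have "ennreal (\<Sum>t'\<in>{t..m}. Phi t / Phi t' * v (t - 1) t' \<xi>) = (\<Sum>t'\<in>{t..m}. ennreal (Phi t / Phi t' * v (t - 1) t' \<xi>))"
        using c0[OF t] v0 by (intro sum_ennreal[symmetric] mult_nonneg_nonneg) auto
      also have "\<dots> = (\<Sum>t'\<in>{t..m}. ennreal (Phi t / Phi t') * ennreal (v (t - 1) t' \<xi>))"
        using c0[OF t] v0 by (intro sum.cong ennreal_mult) auto
      finally have e: "ennreal (\<Sum>t'\<in>{t..m}. Phi t / Phi t' * v (t - 1) t' \<xi>)
          = (\<Sum>t'\<in>{t..m}. ennreal (Phi t / Phi t') * ennreal (v (t - 1) t' \<xi>))" .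
      show "ennreal (v r t \<xi> + (\<Sum>t'\<in>{t..m}. Phi t / Phi t' * v (t - 1) t' \<xi>))
          = ennreal (v r t \<xi>) + (\<Sum>t'\<in>{t..m}. ennreal (Phi t / Phi t') * ennreal (v (t - 1) t' \<xi>))"
        unfolding e[symmetric] by (rule ennreal_plus[OF v0 sum_nonneg[OF mult_nonneg_nonneg[OF c0[OF t] v0]]])
    qed
    finally show "ennreal (\<Sum>t\<in>{r<..m}. v r t \<xi> + (\<Sum>t'\<in>{t..m}. Phi t / Phi t' * v (t - 1) t' \<xi>))
        = (\<Sum>t\<in>{r<..m}. ennreal (v r t \<xi>) + (\<Sum>t'\<in>{t..m}. ennreal (Phi t / Phi t') * ennreal (v (t - 1) t' \<xi>)))" .
  qed
  also have "\<dots> = (\<Sum>t\<in>{r<..m}. (\<integral>\<^sup>+ \<xi>. ennreal (v r t \<xi>) \<partial>Q)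
      + (\<Sum>t'\<in>{t..m}. ennreal (Phi t / Phi t') * (\<integral>\<^sup>+ \<xi>. ennreal (v (t - 1) t' \<xi>) \<partial>Q)))"
    by (simp add: nn_integral_sum nn_integral_add nn_integral_cmult del: One_nat_def)
  also have "\<dots> \<le> (\<Sum>t\<in>{r<..m}. ennreal (I t))"
  proof (intro sum_mono)
    fix t assume t: "t \<in> {r<..m}"
    have "(\<integral>\<^sup>+ \<xi>. ennreal (v r t \<xi>) \<partial>Q) + (\<Sum>t'\<in>{t..m}. ennreal (Phi t / Phi t') * (\<integral>\<^sup>+ \<xi>. ennreal (v (t - 1) t' \<xi>) \<partial>Q))
      \<le> ennreal (64 * Phi t / real t ^ 6) + (\<Sum>t'\<in>{t..m}. ennreal (Phi t / Phi t') * ennreal (64 * Phi t' / real t' ^ 6))"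
      using t r by (intro add_mono sum_mono mult_left_mono v_le) auto
    also have "(\<Sum>t'\<in>{t..m}. ennreal (Phi t / Phi t') * ennreal (64 * Phi t' / real t' ^ 6))
        = (\<Sum>t'\<in>{t..m}. ennreal (Phi t / Phi t' * (64 * Phi t' / real t' ^ 6)))"
    proof (intro sum.cong refl)
      fix t' assume "t' \<in> {t..m}"
      then have "Phi t > 0" "Phi t' > 0" using Pp[of t] Pp[of t'] t by auto
      then show "ennreal (Phi t / Phi t') * ennreal (64 * Phi t' / real t' ^ 6)
          = ennreal (Phi t / Phi t' * (64 * Phi t' / real t' ^ 6))"
        by (subst ennreal_mult) auto
    qed
    also have "\<dots> = ennreal (\<Sum>t'\<in>{t..m}. Phi t / Phi t' * (64 * Phi t' / real t' ^ 6))"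
    proof (intro sum_ennreal)
      fix t' assume "t' \<in> {t..m}"
      then have "Phi t > 0" "Phi t' > 0" using Pp[of t] Pp[of t'] t by auto
      then show "0 \<le> Phi t / Phi t' * (64 * Phi t' / real t' ^ 6)" by simp
    qed
    also have "ennreal (64 * Phi t / real t ^ 6) + \<dots> = ennreal (I t)"
      unfolding I_def
    proof (intro ennreal_plus[symmetric] sum_nonneg)
      show "0 \<le> 64 * Phi t / real t ^ 6" using Pp[of t] t by simp
      fix t' assume "t' \<in> {t..m}"
      then have "Phi t > 0" "Phi t' > 0" using Pp[of t] Pp[of t'] t by auto
      then show "0 \<le> Phi t / Phi t' * (64 * Phi t' / real t' ^ 6)" by simp
    qed
    finally show "(\<integral>\<^sup>+ \<xi>. ennreal (v r t \<xi>) \<partial>Q) + (\<Sum>t'\<in>{t..m}. ennreal (Phi t / Phi t') * (\<integral>\<^sup>+ \<xi>. ennreal (v (t - 1) t' \<xi>) \<partial>Q))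
      \<le> ennreal (I t)" .
  qed
  also have "\<dots> \<le> (\<Sum>t\<in>{r<..m}. ennreal (192 * Phi r * (1 / (real t)\<^sup>2)))"
  proof (intro sum_mono ennreal_leI)
    fix t assume t: "t \<in> {r<..m}"
    have Pt: "Phi t > 0" "Phi r > 0" using Pp[of t] Pp[of r] t by auto
    have tpos: "real t \<ge> 1" using t r by simp
    have "(\<Sum>t'\<in>{t..m}. Phi t / Phi t' * (64 * Phi t' / real t' ^ 6))
        \<le> (\<Sum>t'\<in>{t..m}. 64 * Phi t / real t ^ 4 * (1 / (real t')\<^sup>2))"
    proof (intro sum_mono)
      fix t' assume t': "t' \<in> {t..m}"
      then have "Phi t' > 0" using Pp[of t'] t by auto
      then have "Phi t / Phi t' * (64 * Phi t' / real t' ^ 6) = 64 * Phi t * (1 / real t' ^ 6)" by simp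
      \<comment> \<open>Four powers are moved from \<open>t'\<close> to the smaller
        \<open>t\<close>; two stay behind to make the sum over \<open>t'\<close> converge.\<close>
      also have "real t' ^ 6 = real t' ^ 4 * (real t')\<^sup>2" by (simp add: power_add[symmetric])
      also have "1 / (real t' ^ 4 * (real t')\<^sup>2) \<le> 1 / (real t ^ 4 * (real t')\<^sup>2)"
        using t' tpos by (intro divide_left_mono mult_right_mono power_mono) auto
      finally show "Phi t / Phi t' * (64 * Phi t' / real t' ^ 6) \<le> 64 * Phi t / real t ^ 4 * (1 / (real t')\<^sup>2)"
        using Pt by (simp add: field_simps)
    qed
    also have "\<dots> = 64 * Phi t / real t ^ 4 * (\<Sum>t'\<in>{t..m}. 1 / (real t')\<^sup>2)"
      by (simp add: sum_distrib_left)
    also have "\<dots> \<le> 64 * Phi t / real t ^ 4 * 2"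
      using Pt t r by (intro mult_left_mono sum_inverse_squares_subset_le[of _ m]) auto
    finally have "I t \<le> 64 * Phi t / real t ^ 6 + 128 * Phi t / real t ^ 4" by (simp add: I_def)
    also have "64 * Phi t / real t ^ 6 \<le> 64 * Phi t / real t ^ 4"
      using Pt tpos by (intro divide_left_mono power_increasing) auto
    finally have "I t \<le> 192 * Phi t / real t ^ 4" by simp
    also have "\<dots> \<le> 192 * ((real t)\<^sup>2 * Phi r) / real t ^ 4"
      using t r by (intro divide_right_mono mult_left_mono Phi_adp_growth) (auto simp: m_def)
    also have "\<dots> = 192 * Phi r * (1 / (real t)\<^sup>2)"
      using tpos by (simp add: field_simps power2_eq_square power4_eq_xxxx)
    finally show "I t \<le> 192 * Phi r * (1 / (real t)\<^sup>2)" .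
  qed
  also have "\<dots> = ennreal (192 * Phi r * (\<Sum>t\<in>{r<..m}. 1 / (real t)\<^sup>2))"
    using Phi_adp_pos[OF r] unfolding sum_distrib_left by (intro sum_ennreal) auto
  also have "\<dots> \<le> ennreal (192 * Phi r * 2)"
    using Phi_adp_pos[OF r] r by (intro ennreal_leI mult_left_mono sum_inverse_squares_subset_le[of _ m]) auto
  finally show ?thesis by (simp add: v_def m_def)
qed

text \<open>The factor \<open>k\<close>, later the square of \<sigma>, stays inside the integral:
  only the majorant of the loss, not \<open>L_tilde\<close> itself, is shown to be
  measurable.\<close>

lemma adaptive_risk_le:
  assumes s: "1 \<le> s" "s \<le> d" and sparse: "card {j \<in> {1..d}. \<theta> j \<noteq> 0} \<le> s"
    and zeta: "\<zeta> > 0" "sqrt \<zeta> \<ge> 2 * \<tau> * max 2 (4 * half_level_const \<alpha>)" "sqrt \<zeta> \<ge> 4 * (mgf_const \<alpha> \<tau> + 6)"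
    and "k \<ge> 0"
  shows "(\<integral>\<^sup>+ \<xi>. ennreal (k * (L_tilde \<zeta> \<alpha> \<tau> d \<eta> 1 (\<lambda>j. \<theta> j + \<xi> j) - lin_func d \<eta> \<theta>)\<^sup>2) \<partial>Q)
    \<le> ennreal (k * ((4 * (exp 1 * sq_const \<alpha> \<tau> + \<tau>\<^sup>2) + 2 * \<zeta> + 768) * Phi s))"
proof -
  \<comment> \<open>The rate is constant beyond \<open>s0\<close>, so \<open>r\<close> is the
    comparison level. For \<open>s\<close> above \<open>s0\<close> its threshold is 0 and no larger
    level enters the sum.\<close>
  define r where "r = min s s0"
  have r: "1 \<le> r" "r \<le> s0" "r \<le> d" using s s0_ge_1 by (auto simp: r_def)
  have Pr: "Phi r = Phi s" "Phi r > 0"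
    using Phi_adp_const[of s] Phi_adp_pos[OF r(1,2)] by (auto simp: r_def min_def)
  have sp1: "card {j \<in> {1..d}. \<theta> j \<noteq> 0} \<le> r \<or> lam (real r) = 0"
    using sparse lam_zero[of s0] s by (auto simp: r_def min_def)
  have sp2: "card {j \<in> {1..d}. \<theta> j \<noteq> 0} \<le> r" if "r < min s0 d"
    using sparse that by (auto simp: r_def min_def split: if_splits)
  define W where "W = (\<lambda>\<xi>. \<Sum>t\<in>{r<..min s0 d}. V \<zeta> r t (\<lambda>j. \<theta> j + \<xi> j)
      + (\<Sum>t'\<in>{t..min s0 d}. Phi t / Phi t' * V \<zeta> (t - 1) t' (\<lambda>j. \<theta> j + \<xi> j)))"
  define E where "E = (\<lambda>\<xi>. L_hat \<alpha> \<tau> d \<eta> 1 r (\<lambda>j. \<theta> j + \<xi> j) - lin_func d \<eta> \<theta>)"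
  have Wm[measurable]: "W \<in> borel_measurable Q" unfolding W_def by measurable
  have Em[measurable]: "E \<in> borel_measurable Q" unfolding E_def by measurable
  have "ennreal (k * (L_tilde \<zeta> \<alpha> \<tau> d \<eta> 1 (\<lambda>j. \<theta> j + \<xi> j) - lin_func d \<eta> \<theta>)\<^sup>2)
      \<le> ennreal (2 * k) * (ennreal ((E \<xi>)\<^sup>2) + (ennreal (\<zeta> * Phi r) + ennreal (W \<xi>)))" for \<xi>
  proof -
    define D where "D = L_tilde \<zeta> \<alpha> \<tau> d \<eta> 1 (\<lambda>j. \<theta> j + \<xi> j) - L_hat \<alpha> \<tau> d \<eta> 1 r (\<lambda>j. \<theta> j + \<xi> j)"
    have D: "D\<^sup>2 \<le> \<zeta> * Phi r + W \<xi>"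
      unfolding D_def W_def L_tilde_def by (rule selected_error_le[OF zeta(1) r])
    have "(L_tilde \<zeta> \<alpha> \<tau> d \<eta> 1 (\<lambda>j. \<theta> j + \<xi> j) - lin_func d \<eta> \<theta>)\<^sup>2 = (D + E \<xi>)\<^sup>2"
      by (simp add: D_def E_def)
    also have "\<dots> \<le> 2 * (E \<xi>)\<^sup>2 + 2 * D\<^sup>2"
      using zero_le_power2[of "D - E \<xi>"] by (simp add: power2_eq_square algebra_simps)
    also have "\<dots> \<le> 2 * ((E \<xi>)\<^sup>2 + (\<zeta> * Phi r + W \<xi>))" using D by simp
    finally have "k * (L_tilde \<zeta> \<alpha> \<tau> d \<eta> 1 (\<lambda>j. \<theta> j + \<xi> j) - lin_func d \<eta> \<theta>)\<^sup>2
        \<le> k * (2 * ((E \<xi>)\<^sup>2 + (\<zeta> * Phi r + W \<xi>)))" using \<open>k \<ge> 0\<close> by (rule mult_left_mono)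
    also have "\<dots> = 2 * k * ((E \<xi>)\<^sup>2 + (\<zeta> * Phi r + W \<xi>))" by simp
    finally have "ennreal (k * (L_tilde \<zeta> \<alpha> \<tau> d \<eta> 1 (\<lambda>j. \<theta> j + \<xi> j) - lin_func d \<eta> \<theta>)\<^sup>2)
        \<le> ennreal (2 * k * ((E \<xi>)\<^sup>2 + (\<zeta> * Phi r + W \<xi>)))" by (rule ennreal_leI)
    moreover have "W \<xi> \<ge> 0"
    proof -
      have "Phi t > 0" if "r \<le> t" "t \<le> min s0 d" for t
        using that r by (intro Phi_adp_pos) auto
      then show ?thesis unfolding W_def
        by (intro sum_nonneg add_nonneg_nonneg mult_nonneg_nonneg divide_nonneg_nonneg V_nonneg) (auto simp: less_imp_le)
    qed
    moreover have "ennreal (x * (a + (b + c))) = ennreal x * (ennreal a + (ennreal b + ennreal c))"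
      if "x \<ge> 0" "a \<ge> 0" "b \<ge> 0" "c \<ge> 0" for x a b c :: real
      using that by (simp add: ennreal_mult)
    ultimately show ?thesis using \<open>k \<ge> 0\<close> zeta(1) Pr(2) by simp
  qed
  then have "(\<integral>\<^sup>+ \<xi>. ennreal (k * (L_tilde \<zeta> \<alpha> \<tau> d \<eta> 1 (\<lambda>j. \<theta> j + \<xi> j) - lin_func d \<eta> \<theta>)\<^sup>2) \<partial>Q)
      \<le> (\<integral>\<^sup>+ \<xi>. ennreal (2 * k) * (ennreal ((E \<xi>)\<^sup>2) + (ennreal (\<zeta> * Phi r) + ennreal (W \<xi>))) \<partial>Q)"
    by (intro nn_integral_mono)
  also have "\<dots> = ennreal (2 * k) * ((\<integral>\<^sup>+ \<xi>. ennreal ((E \<xi>)\<^sup>2) \<partial>Q) + (ennreal (\<zeta> * Phi r) + (\<integral>\<^sup>+ \<xi>. ennreal (W \<xi>) \<partial>Q)))"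
    by (simp add: nn_integral_cmult nn_integral_add Q.emeasure_space_1 del: One_nat_def)
  also have "\<dots> \<le> ennreal (2 * k) * (ennreal (2 * (exp 1 * sq_const \<alpha> \<tau> + \<tau>\<^sup>2) * rate (real r)) + (ennreal (\<zeta> * Phi r) + ennreal (384 * Phi r)))"
    unfolding E_def W_def
    by (intro mult_left_mono add_mono order_refl risk_le[OF r(1) sp1] sum_V_le[OF r(1,2) sp2 zeta]) auto
  also have "\<dots> \<le> ennreal (2 * k) * (ennreal (2 * (exp 1 * sq_const \<alpha> \<tau> + \<tau>\<^sup>2) * Phi r) + (ennreal (\<zeta> * Phi r) + ennreal (384 * Phi r)))"
    using sq_const_nonneg rate_le_Phi_adp[OF r(1,2)]
    by (intro mult_left_mono add_right_mono ennreal_leI) auto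
  also have "\<dots> = ennreal (k * ((4 * (exp 1 * sq_const \<alpha> \<tau> + \<tau>\<^sup>2) + 2 * \<zeta> + 768) * Phi s))"
  proof -
    have "0 \<le> 2 * (exp 1 * sq_const \<alpha> \<tau> + \<tau>\<^sup>2) * Phi r" using sq_const_nonneg Pr(2) by simp
    then have "ennreal (2 * (exp 1 * sq_const \<alpha> \<tau> + \<tau>\<^sup>2) * Phi r) + (ennreal (\<zeta> * Phi r) + ennreal (384 * Phi r))
        = ennreal (2 * (exp 1 * sq_const \<alpha> \<tau> + \<tau>\<^sup>2) * Phi r + (\<zeta> * Phi r + 384 * Phi r))"
      using Pr(2) zeta(1) by (simp flip: ennreal_plus)
    moreover have "ennreal (2 * k) * ennreal x = ennreal (2 * k * x)" if "x \<ge> 0" for x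
      using \<open>k \<ge> 0\<close> that by (simp add: ennreal_mult)
    moreover have "2 * k * (2 * (exp 1 * sq_const \<alpha> \<tau> + \<tau>\<^sup>2) * Phi r + (\<zeta> * Phi r + 384 * Phi r))
        = k * ((4 * (exp 1 * sq_const \<alpha> \<tau> + \<tau>\<^sup>2) + 2 * \<zeta> + 768) * Phi s)"
      unfolding Pr by (simp add: algebra_simps)
    ultimately show ?thesis
      using \<open>0 \<le> 2 * (exp 1 * sq_const \<alpha> \<tau> + \<tau>\<^sup>2) * Phi r\<close> Pr(2) zeta(1)
      by (metis add_nonneg_nonneg less_imp_le mult_nonneg_nonneg zero_le_numeral)
  qed
  finally show ?thesis .
qed

end

section \<open>Scaling in \<sigma> and conclusion\<close>

lemma L_hat_scale:
  assumes "\<sigma> > 0"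
  shows "L_hat \<alpha> \<tau> d \<eta> \<sigma> s (\<lambda>j. \<sigma> * y j) = \<sigma> * L_hat \<alpha> \<tau> d \<eta> 1 s y"
proof -
  have "\<bar>\<eta> j * (\<sigma> * y j)\<bar> > \<sigma> * \<tau> * c \<longleftrightarrow> \<bar>\<eta> j * y j\<bar> > 1 * \<tau> * c" for j c
  proof -
    have "\<bar>\<eta> j * (\<sigma> * y j)\<bar> = \<sigma> * \<bar>\<eta> j * y j\<bar>" using assms by (simp add: abs_mult)
    then show ?thesis using assms by (simp add: mult.assoc)
  qed
  then show ?thesis
    unfolding L_hat_def distrib_left sum_distrib_left
    by (intro arg_cong2[of _ _ _ _ "(+)"] sum.cong) auto
qed

text \<open>Estimators and tolerances are all proportional to \<sigma>, so every comparison, and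
  hence the selected level, is unchanged.\<close>

lemma L_tilde_scale:
  assumes "\<sigma> > 0"
  shows "L_tilde \<zeta> \<alpha> \<tau> d \<eta> \<sigma> (\<lambda>j. \<sigma> * y j) = \<sigma> * L_tilde \<zeta> \<alpha> \<tau> d \<eta> 1 y"
proof -
  have "omega \<zeta> \<alpha> d \<eta> \<sigma> s = \<sigma> * omega \<zeta> \<alpha> d \<eta> 1 s" for s
    using assms by (simp add: omega_def real_sqrt_mult)
  moreover have "\<bar>\<sigma> * x - \<sigma> * y\<bar> \<le> \<sigma> * z \<longleftrightarrow> \<bar>x - y\<bar> \<le> z" for x y z
  proof -
    have "\<bar>\<sigma> * x - \<sigma> * y\<bar> = \<sigma> * \<bar>x - y\<bar>" using assms by (simp add: abs_mult flip: right_diff_distrib)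
    then show ?thesis using assms by simp
  qed
  ultimately have "s_hat \<zeta> \<alpha> \<tau> d \<eta> \<sigma> (\<lambda>j. \<sigma> * y j) = s_hat \<zeta> \<alpha> \<tau> d \<eta> 1 y"
    unfolding s_hat_def L_hat_scale[OF assms] by simp
  then show ?thesis by (simp add: L_tilde_def L_hat_scale[OF assms])
qed

theorem theorem3:
  fixes \<alpha> \<tau> :: real
  assumes "\<alpha> > 0" and "\<tau> > 0"
  shows "\<exists>\<zeta>>0. \<exists>C>0. \<forall>d\<ge>1. \<forall>\<eta> :: nat \<Rightarrow> real. \<forall>\<sigma>>0. \<forall>s\<in>{1..d}.
    antimono_on {1..d} (\<lambda>j. \<bar>\<eta> j\<bar>) \<and> \<bar>\<eta> d\<bar> > 0 \<longrightarrow>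
    (SUP \<theta>\<in>sparse_set d s. SUP Q\<in>noise_class_prod \<alpha> \<tau> d.
        mse d \<eta> \<sigma> (L_tilde \<zeta> \<alpha> \<tau> d \<eta> \<sigma>) \<theta> Q)
      \<le> ennreal (C * \<sigma>\<^sup>2 * Phi_adp \<alpha> d \<eta> (real s))"
proof -
  \<comment> \<open>The two bounds serve the support part and the Chernoff part of
    \<open>V_le\<close>; both depend on \<alpha> and \<tau> only.\<close>
  define z where "z = max (2 * \<tau> * max 2 (4 * half_level_const \<alpha>)) (4 * (mgf_const \<alpha> \<tau> + 6))"
  define \<zeta> where "\<zeta> = z\<^sup>2"
  have "4 * (mgf_const \<alpha> \<tau> + 6) \<le> z" by (simp add: z_def)
  then have z: "z > 0" using mgf_const_ge(4)[of \<alpha> \<tau>] by (simp add: algebra_simps)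
  have zeta: "\<zeta> > 0" "sqrt \<zeta> \<ge> 2 * \<tau> * max 2 (4 * half_level_const \<alpha>)" "sqrt \<zeta> \<ge> 4 * (mgf_const \<alpha> \<tau> + 6)"
  proof -
    have "sqrt \<zeta> = z" using z by (simp add: \<zeta>_def)
    then show "\<zeta> > 0" "sqrt \<zeta> \<ge> 2 * \<tau> * max 2 (4 * half_level_const \<alpha>)" "sqrt \<zeta> \<ge> 4 * (mgf_const \<alpha> \<tau> + 6)"
      using z by (simp_all add: \<zeta>_def z_def)
  qed
  define C where "C = 4 * (exp 1 * sq_const \<alpha> \<tau> + \<tau>\<^sup>2) + 2 * \<zeta> + 768"
  have "0 \<le> exp 1 * sq_const \<alpha> \<tau> + \<tau>\<^sup>2" using sq_const_nonneg by simp
  then have C: "C > 0" unfolding C_def using zeta(1)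
    by (intro add_nonneg_pos add_nonneg_nonneg) (simp_all del: distrib_left_numeral)
  have main: "mse d \<eta> \<sigma> (L_tilde \<zeta> \<alpha> \<tau> d \<eta> \<sigma>) \<theta> Q \<le> ennreal (C * \<sigma>\<^sup>2 * Phi_adp \<alpha> d \<eta> (real s))"
    if d: "d \<ge> 1" and sg: "\<sigma> > 0" and s: "s \<in> {1..d}"
      and eta: "antimono_on {1..d} (\<lambda>j. \<bar>\<eta> j\<bar>)" "\<bar>\<eta> d\<bar> > 0"
      and theta: "\<theta> \<in> sparse_set d s" and Q: "Q \<in> noise_class_prod \<alpha> \<tau> d"
    for d s :: nat and \<eta> \<theta> :: "nat \<Rightarrow> real" and \<sigma> :: real and Q :: "(nat \<Rightarrow> real) measure"
  proof -
    obtain P where P: "Q = Pi\<^sub>M {1..d} P" "\<And>j. j \<in> {1..d} \<Longrightarrow> P j \<in> noise_class \<alpha> \<tau>"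
      using Q by (auto simp: noise_class_prod_def)
    interpret loss_noise \<alpha> d \<eta> \<tau> P
      using assms d eta P(2) by unfold_locales
    \<comment> \<open>Dividing by \<sigma> keeps the support and reduces the problem to noise level
      1.\<close>
    define \<theta>' where "\<theta>' = (\<lambda>j. \<theta> j / \<sigma>)"
    have "{j \<in> {1..d}. \<theta>' j \<noteq> 0} = {j \<in> {1..d}. \<theta> j \<noteq> 0}" using sg by (auto simp: \<theta>'_def)
    then have sparse: "card {j \<in> {1..d}. \<theta>' j \<noteq> 0} \<le> s" using theta by (simp add: sparse_set_def)
    have shift: "(\<lambda>j. \<theta> j + \<sigma> * \<xi> j) = (\<lambda>j. \<sigma> * (\<theta>' j + \<xi> j))" for \<xi>
      using sg by (simp add: \<theta>'_def distrib_left)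
    have lin: "lin_func d \<eta> \<theta> = \<sigma> * lin_func d \<eta> \<theta>'"
      using sg by (simp add: lin_func_def \<theta>'_def sum_distrib_left)
    have "mse d \<eta> \<sigma> (L_tilde \<zeta> \<alpha> \<tau> d \<eta> \<sigma>) \<theta> Q
        = (\<integral>\<^sup>+ \<xi>. ennreal (\<sigma>\<^sup>2 * (L_tilde \<zeta> \<alpha> \<tau> d \<eta> 1 (\<lambda>j. \<theta>' j + \<xi> j) - lin_func d \<eta> \<theta>')\<^sup>2) \<partial>Pi\<^sub>M {1..d} P)"
      unfolding mse_def P(1) shift L_tilde_scale[OF sg] lin
      by (simp only: right_diff_distrib[symmetric] power_mult_distrib)
    also have "\<dots> \<le> ennreal (\<sigma>\<^sup>2 * (C * Phi_adp \<alpha> d \<eta> (real s)))"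
      unfolding C_def using s sparse zeta by (intro adaptive_risk_le) auto
    finally show ?thesis by (simp add: mult_ac)
  qed
  show ?thesis
    using zeta(1) C main by (intro exI[of _ \<zeta>] exI[of _ C] conjI allI impI ballI SUP_least) auto
qed

end
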